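(* Let $\max\{|a|,|b|,|c|,|d|\}<1$ and $cd\rho\neq 0$. Let $H_n(z)=H_n(a,b,c,d;z)$ be the $q$-Hahn polynomials $$H_n(a,b,c,d;z)=\frac{(ac,ad;q)_n}{a^n}\,{}_3\phi_2\left({{q^{-n},\,abcdq^{n-1},\,az}\atop{ac,\ ad}};q,q\right),$$ and put $$K(\theta)=\frac{(\rho e^{i\theta}/d,\ qde^{-i\theta}/\rho,\ \rho ce^{-i\theta},\ qe^{i\theta}/(c\rho);q)_\infty}{(ae^{i\theta},be^{i\theta},ce^{-i\theta},de^{-i\theta};q)_\infty},$$ $$L_0=\frac{(abcd,\ \rho,\ q/\rho,\ c\rho/d,\ qd/(c\rho);q)_\infty}{(q,ac,ad,bc,bd;q)_\infty},\qquad L_n=\frac{(1-abcdq^{-1})(q,ac,ad,bc,bd;q)_n\,q^{n(n-1)/2}(-cd)^n}{(1-abcdq^{2n-1})(abcdq^{-1};q)_n}\,L_0.$$ Then for all nonnegative integers $m,n$, $$\frac{1}{2\pi}\int_{-\pi}^{\pi}K(\theta)H_n(e^{i\theta})H_m(e^{i\theta})\,d\theta=L_n\,\delta_{m,n}.$$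
   Context: Here $q$ is a nonzero complex number with $|q|<1$, and $a,b,c,d,\rho$ are complex parameters such that no zero factors occur in denominators. Notation: $(x;q)_0=1$, $(x;q)_n=\prod_{k=0}^{n-1}(1-xq^k)$ for $n=1,2,\dots$ or $n=\infty$, and $(x_1,\dots,x_r;q)_n=(x_1;q)_n\cdots(x_r;q)_n$. The basic hypergeometric series is $${}_3\phi_2\left({{a_1,a_2,a_3}\atop{b_1,b_2}};q,z\right)=\sum_{k=0}^\infty\frac{(a_1,a_2,a_3;q)_k}{(q,b_1,b_2;q)_k}z^k,$$ and $\delta_{m,n}$ is the Kronecker delta. *)

theory Defs
  imports "HOL-Analysis.Analysis"
begin

definition qpoch :: "complex \<Rightarrow> complex \<Rightarrow> nat \<Rightarrow> complex" where
  "qpoch q x n = (\<Prod>k<n. 1 - x * q ^ k)"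

(* For |q| < 1 the infinite product converges in the sense of has_prod, which
   admits finitely many vanishing factors (the value is then 0). *)
definition qpoch_inf :: "complex \<Rightarrow> complex \<Rightarrow> complex" where
  "qpoch_inf q x = (\<Prod>k. 1 - x * q ^ k)"

definition qpochs :: "complex \<Rightarrow> complex list \<Rightarrow> nat \<Rightarrow> complex" where
  "qpochs q xs n = (\<Prod>x\<leftarrow>xs. qpoch q x n)"

definition qpochs_inf :: "complex \<Rightarrow> complex list \<Rightarrow> complex" where
  "qpochs_inf q xs = (\<Prod>x\<leftarrow>xs. qpoch_inf q x)"

definition phi32 ::
  "complex \<Rightarrow> complex \<Rightarrow> complex \<Rightarrow> complex \<Rightarrow> complex \<Rightarrow> complex \<Rightarrow> complex \<Rightarrow> complex" where
  "phi32 a1 a2 a3 b1 b2 q z =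
     (\<Sum>k. qpochs q [a1, a2, a3] k / qpochs q [q, b1, b2] k * z ^ k)"

definition q_Hahn ::
  "complex \<Rightarrow> complex \<Rightarrow> complex \<Rightarrow> complex \<Rightarrow> complex \<Rightarrow> nat \<Rightarrow> complex \<Rightarrow> complex" where
  "q_Hahn q a b c d n z =
     qpochs q [a * c, a * d] n / a ^ n *
     phi32 (q powi (- int n)) (a * b * c * d * q powi (int n - 1)) (a * z) (a * c) (a * d) q q"

definition q_Hahn_weight ::
  "complex \<Rightarrow> complex \<Rightarrow> complex \<Rightarrow> complex \<Rightarrow> complex \<Rightarrow> complex \<Rightarrow> real \<Rightarrow> complex" where
  "q_Hahn_weight q a b c d \<rho> \<theta> =
     qpochs_inf q [\<rho> * cis \<theta> / d, q * d * cis (- \<theta>) / \<rho>, \<rho> * c * cis (- \<theta>), q * cis \<theta> / (c * \<rho>)] /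
     qpochs_inf q [a * cis \<theta>, b * cis \<theta>, c * cis (- \<theta>), d * cis (- \<theta>)]"

definition q_Hahn_L0 ::
  "complex \<Rightarrow> complex \<Rightarrow> complex \<Rightarrow> complex \<Rightarrow> complex \<Rightarrow> complex \<Rightarrow> complex" where
  "q_Hahn_L0 q a b c d \<rho> =
     qpochs_inf q [a * b * c * d, \<rho>, q / \<rho>, c * \<rho> / d, q * d / (c * \<rho>)] /
     qpochs_inf q [q, a * c, a * d, b * c, b * d]"

(* The exponent n (n - 1) / 2 is a natural number, so div is exact here. *)
definition q_Hahn_L ::
  "complex \<Rightarrow> complex \<Rightarrow> complex \<Rightarrow> complex \<Rightarrow> complex \<Rightarrow> complex \<Rightarrow> nat \<Rightarrow> complex" where
  "q_Hahn_L q a b c d \<rho> n =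
     (1 - a * b * c * d * q powi (- 1)) * qpochs q [q, a * c, a * d, b * c, b * d] n *
       q ^ (n * (n - 1) div 2) * (- (c * d)) ^ n /
     ((1 - a * b * c * d * q powi (2 * int n - 1)) * qpoch q (a * b * c * d * q powi (- 1)) n) *
     q_Hahn_L0 q a b c d \<rho>"

end

theory Submission
  imports Defs "HOL-Complex_Analysis.Complex_Analysis"
begin

text \<open>
  Write the weight on the unit circle as \<open>N(z) W(z)\<close>, where
  \<open>W(z) = 1 / (az, bz, c/z, d/z; q)\<^sub>\<infinity>\<close> and \<open>N\<close> is the numerator, a product of two theta functions.  The
  only property of \<open>N\<close> that matters is that it is holomorphic on the punctured plane and satisfies
  \<open>q z\<^sup>2 N(qz) = c d N(z)\<close>; the parameter \<open>\<rho>\<close> merely selects a member of this space of functions.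

  Total mass (the Askey--Roy integral).  Write \<open>I(c, N)\<close> for the mean of \<open>N W\<close> over the unit circle.
  Replacing the circle by the circle of radius \<open>|q|\<close> in the integral of \<open>(z - c)(z - d) N(z) W(z) / z\<close>, where
  no pole is crossed, gives the contiguous relation
  \<open>(1 - abcd) I(cq, zN) = d (1 - ac)(1 - bc) I(c, N)\<close>: multiplying \<open>N W\<close> by \<open>z - c\<close> is the same as
  passing from \<open>(c, N)\<close> to \<open>(cq, zN)\<close>, and \<open>zN\<close> again satisfies the functional equation.  Iteration expresses
  \<open>I(c, N)\<close> through the means of \<open>(z/d)^j N(z) W(z)\<close> with \<open>c\<close> replaced by \<open>c q^j\<close>.  Moving that contour
  inside \<open>|z| = |d|\<close> picks up the residue at \<open>z = d\<close>, and the remaining integral is geometrically small, so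
  the limit \<open>j \<rightarrow> \<infinity>\<close> evaluates \<open>I(c, N)\<close> in closed form (\<open>Askey_Roy_integral\<close>).

  Moments.  Multiplying the weight by \<open>(az; q)\<^sub>k\<close> and by the monic polynomial
  \<open>g\<^sub>j(z) = (z - c)(z - cq) \<dots> (z - cq\<^bsup>j-1\<^esup>)\<close> turns it into the weight for \<open>(aq^k, cq^j, z^j N)\<close>.  Hence every
  mixed moment is again an Askey--Roy integral (\<open>functional_moment\<close>).

  Orthogonality.  Inserting these moments into the series for \<open>H\<^sub>n\<close>, the integral of \<open>H\<^sub>n g\<^sub>j\<close> becomes a
  terminating sum \<open>\<Sum>\<^sub>k (q\<^bsup>-n\<^esup>; q)\<^sub>k / (q; q)\<^sub>k q^k p(q^k)\<close>.  Such a sum is the value at \<open>x = 1\<close> of the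
  operator \<open>\<Prod>\<^sub>i\<^sub><\<^sub>n (1 - q\<^bsup>-i\<^esup> T)\<close>, \<open>T p(x) = p(qx)\<close>, which kills all polynomials of degree below
  \<open>n\<close>.  For \<open>j < n\<close> the function \<open>p\<close> is a polynomial of degree \<open>n - 1\<close>, so the integral vanishes; for
  \<open>j = n\<close> it is a polynomial of degree \<open>n\<close> over a linear factor, where the operator has an explicit value
  (\<open>qdiff_qpoch_over_linear\<close>).  Since \<open>H\<^sub>m\<close> is a combination of \<open>g\<^sub>0, \<dots>, g\<^sub>m\<close> with leading coefficient
  \<open>(abcdq\<^bsup>m-1\<^esup>; q)\<^sub>m\<close>, both the orthogonality and the norm follow.  Testing against the \<open>g\<^sub>j\<close> instead of the
  products \<open>(bz; q)\<^sub>j\<close> keeps the argument uniform in \<open>b\<close>, because the latter do not span when \<open>b = 0\<close>.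
\<close>

section \<open>Finite and infinite q-shifted factorials\<close>

lemma qpoch_0 [simp]: "qpoch q x 0 = 1"
  by (simp add: qpoch_def)

lemma qpoch_Suc: "qpoch q x (Suc n) = qpoch q x n * (1 - x * q ^ n)"
  by (simp add: qpoch_def)

lemma qpoch_add: "qpoch q x (m + n) = qpoch q x m * qpoch q (x * q ^ m) n"
  by (induction n) (simp_all add: qpoch_Suc power_add mult_ac)

lemma qpoch_Suc_left: "qpoch q x (Suc n) = (1 - x) * qpoch q (x * q) n"
  using qpoch_add[of q x 1 n] by (simp add: qpoch_Suc)

lemma norm_mult_less_one:
  fixes x y :: complex
  assumes "norm x < 1" "norm y \<le> 1"
  shows "norm (x * y) < 1"
proof -
  have "norm (x * y) \<le> norm x"
    using assms(2) by (simp add: norm_mult mult_left_le)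
  with assms(1) show ?thesis by linarith
qed

lemma norm_mult_power_less_one:
  fixes x q :: complex
  assumes "norm x < 1" "norm q < 1"
  shows "norm (x * q ^ k) < 1"
  using assms by (intro norm_mult_less_one) (auto simp: norm_power power_le_one)

lemma qpoch_nonzero:
  assumes "norm x < 1" "norm q < 1"
  shows "qpoch q x n \<noteq> 0"
proof -
  have "x * q ^ k \<noteq> 1" for k
    using norm_mult_power_less_one[OF assms, of k] by auto
  then show ?thesis by (auto simp: qpoch_def)
qed

context
  fixes q :: complex
  assumes q1: "norm q < 1"
begin

lemma qpoch_inf_has_prod: "(\<lambda>k. 1 - x * q ^ k) has_prod qpoch_inf q x"
proof -
  have "summable (\<lambda>k. norm x * norm q ^ k)"
    using q1 by (intro summable_mult summable_geometric) auto
  then have "summable (\<lambda>k. norm ((1 - x * q ^ k) - 1))"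
    by (simp add: norm_mult norm_power)
  then have "convergent_prod (\<lambda>k. 1 - x * q ^ k)"
    by (intro abs_convergent_prod_imp_convergent_prod summable_imp_abs_convergent_prod)
  then show ?thesis
    unfolding qpoch_inf_def by (rule convergent_prod_has_prod)
qed

lemma qpoch_tendsto_qpoch_inf: "(\<lambda>n. qpoch q x n) \<longlonglongrightarrow> qpoch_inf q x"
  using has_prod_imp_tendsto'[OF qpoch_inf_has_prod] by (simp add: qpoch_def)

lemma qpoch_inf_split: "qpoch_inf q x = qpoch q x n * qpoch_inf q (x * q ^ n)"
proof (rule LIMSEQ_unique)
  show "(\<lambda>k. qpoch q x (n + k)) \<longlonglongrightarrow> qpoch_inf q x"
    using LIMSEQ_ignore_initial_segment[OF qpoch_tendsto_qpoch_inf, of x n]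
    by (simp add: add.commute)
  show "(\<lambda>k. qpoch q x (n + k)) \<longlonglongrightarrow> qpoch q x n * qpoch_inf q (x * q ^ n)"
    unfolding qpoch_add by (intro tendsto_intros qpoch_tendsto_qpoch_inf)
qed

lemma qpoch_inf_rec: "qpoch_inf q x = (1 - x) * qpoch_inf q (x * q)"
  using qpoch_inf_split[of x 1] by (simp add: qpoch_Suc)

lemma qpoch_inf_0 [simp]: "qpoch_inf q 0 = 1"
  by (simp add: qpoch_inf_def)

lemma qpoch_inf_nonzero:
  assumes "norm x < 1"
  shows "qpoch_inf q x \<noteq> 0"
proof -
  have "1 - x * q ^ k \<noteq> 0" for k
    using norm_mult_power_less_one[OF assms q1, of k] by auto
  then show ?thesis
    using has_prod_eq_0_iff[OF qpoch_inf_has_prod[of x]] by auto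
qed

lemma holomorphic_qpoch_inf_UNIV: "qpoch_inf q holomorphic_on UNIV"
proof (rule holomorphic_uniform_sequence)
  show "(\<lambda>x. qpoch q x n) holomorphic_on UNIV" for n
    unfolding qpoch_def by (intro holomorphic_intros)
  fix x :: complex
  have "uniformly_convergent_on (cball x 1) (\<lambda>N y. \<Sum>n<N. norm (- (y * q ^ n)))"
  proof (rule Weierstrass_m_test')
    show "summable (\<lambda>n. (norm x + 1) * norm q ^ n)"
      using q1 by (intro summable_mult summable_geometric) auto
    show "norm (norm (- (y * q ^ n))) \<le> (norm x + 1) * norm q ^ n" if "y \<in> cball x 1" for n y
    proof -
      have "norm y \<le> norm x + 1"
        using that norm_triangle_ineq2[of y x] by (auto simp: dist_norm norm_minus_commute)
      then show ?thesis by (simp add: norm_mult norm_power mult_right_mono)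
    qed
  qed
  then have "uniformly_convergent_on (cball x 1) (\<lambda>N y. \<Prod>n<N. 1 + (- (y * q ^ n)))"
    by (intro uniformly_convergent_on_prod continuous_intros compact_cball)
  then have "uniformly_convergent_on (cball x 1) (\<lambda>N y. qpoch q y N)"
    by (simp add: qpoch_def)
  then obtain l where l: "uniform_limit (cball x 1) (\<lambda>N y. qpoch q y N) l sequentially"
    by (auto simp: uniformly_convergent_on_def)
  have "l y = qpoch_inf q y" if "y \<in> cball x 1" for y
    using tendsto_uniform_limitI[OF l that] qpoch_tendsto_qpoch_inf LIMSEQ_unique by blast
  then have "uniform_limit (cball x 1) (\<lambda>N y. qpoch q y N) (qpoch_inf q) sequentially"
    using uniform_limit_cong'[of "cball x 1" "\<lambda>N y. qpoch q y N" "\<lambda>N y. qpoch q y N" l "qpoch_inf q"] l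
    by blast
  then show "\<exists>d>0. cball x d \<subseteq> UNIV \<and> uniform_limit (cball x d) (\<lambda>N y. qpoch q y N) (qpoch_inf q) sequentially"
    by (intro exI[of _ 1]) auto
qed auto

lemma holomorphic_on_qpoch_inf [holomorphic_intros]:
  assumes "f holomorphic_on S"
  shows "(\<lambda>z. qpoch_inf q (f z)) holomorphic_on S"
  using holomorphic_on_compose_gen[OF assms holomorphic_qpoch_inf_UNIV] by (auto simp: o_def)

lemma continuous_on_qpoch_inf [continuous_intros]:
  assumes "continuous_on S f"
  shows "continuous_on S (\<lambda>z. qpoch_inf q (f z))"
  using continuous_on_compose2[OF holomorphic_on_imp_continuous_on[OF holomorphic_qpoch_inf_UNIV] assms]
  by auto

end

section \<open>Means over circles\<close>

definition circle_mean :: "(complex \<Rightarrow> complex) \<Rightarrow> complex" where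
  "circle_mean F = 1 / (2 * of_real pi) * integral {-pi..pi} (\<lambda>\<theta>. F (cis \<theta>))"

lemma circle_mean_conv_contour_integral:
  "circle_mean F = contour_integral (part_circlepath 0 1 (-pi) pi) (\<lambda>z. F z / z) / (2 * of_real pi * \<i>)"
proof -
  have "contour_integral (part_circlepath 0 1 (-pi) pi) (\<lambda>z. F z / z)
        = integral {-pi..pi} (\<lambda>t. \<i> * F (cis t))"
    by (subst contour_integral_part_circlepath_eq) (auto intro!: integral_cong)
  then show ?thesis by (simp add: circle_mean_def)
qed

text \<open>For complex \<open>q\<close> the dilated circle is also rotated, so the two loops are joined by \<open>exp (s Ln q) z\<close>
  for \<open>0 \<le> s \<le> 1\<close>, which stays in the closed annulus.  The invariant measure is \<open>dz/z\<close>, hence \<open>F z / z\<close> in the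
  proof.\<close>
lemma circle_mean_dilate:
  assumes "q \<noteq> 0" "norm q < 1" and "F holomorphic_on S" "open S"
    and S: "\<And>z. norm q \<le> norm z \<Longrightarrow> norm z \<le> 1 \<Longrightarrow> z \<in> S"
  shows "circle_mean (\<lambda>z. F (q * z)) = circle_mean F"
proof -
  define g where "g = part_circlepath 0 1 (-pi) pi"
  define T where "T = S - {0}"
  have g: "g t = exp (\<i> * of_real (linepath (-pi) pi t))" for t
    by (simp add: g_def part_circlepath_def)
  have norm_g: "norm (g t) = 1" for t by (simp add: g)
  have loop: "g 1 = g 0"
    by (simp add: g linepath_def cis_conv_exp[symmetric] complex_eq_iff del: of_real_minus)
  have hom: "homotopic_loops T g (\<lambda>t. q * g t)"
    unfolding homotopic_loops
  proof (intro exI[of _ "\<lambda>(s, t). exp (of_real s * Ln q) * g t"] conjI ballI)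
    show "continuous_on ({0..1} \<times> {0..1}) (\<lambda>(s, t). exp (complex_of_real s * Ln q) * g t)"
      unfolding g linepath_def case_prod_unfold by (intro continuous_intros)
    show "(\<lambda>(s, t). exp (complex_of_real s * Ln q) * g t) \<in> {0..1} \<times> {0..1} \<rightarrow> T"
    proof (clarify)
      fix s t :: real assume st: "s \<in> {0..1}" "t \<in> {0..1}"
      have ln: "ln (norm q) \<le> 0" using assms by (simp add: ln_le_zero_iff)
      have n: "norm (exp (complex_of_real s * Ln q) * g t) = exp (s * ln (norm q))"
        using \<open>q \<noteq> 0\<close> by (simp add: norm_mult norm_g)
      have "s * ln (norm q) \<le> 0" using ln st by (simp add: mult_nonneg_nonpos)
      moreover have "(1 - s) * ln (norm q) \<le> 0" using ln st by (simp add: mult_nonneg_nonpos)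
      then have "ln (norm q) \<le> s * ln (norm q)" by (simp add: algebra_simps)
      then have "exp (ln (norm q)) \<le> exp (s * ln (norm q))" by simp
      then have "norm q \<le> exp (s * ln (norm q))" using \<open>q \<noteq> 0\<close> by simp
      ultimately have "exp (complex_of_real s * Ln q) * g t \<in> S"
        using S n by simp
      moreover have "exp (complex_of_real s * Ln q) * g t \<noteq> 0" by (simp add: g)
      ultimately show "exp (complex_of_real s * Ln q) * g t \<in> T" by (simp add: T_def)
    qed
  qed (use \<open>q \<noteq> 0\<close> loop in \<open>auto simp: pathfinish_def pathstart_def\<close>)
  have vg: "valid_path g" by (simp add: g_def)
  have comp: "(\<lambda>t. q * g t) = (\<lambda>z. q * z) \<circ> g" by (simp add: o_def)
  have an: "(\<lambda>z. q * z) analytic_on UNIV"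
    by (intro analytic_intros)
  have vq: "valid_path (\<lambda>t. q * g t)"
    unfolding comp by (rule valid_path_compose_analytic[OF vg an]) auto
  have FT: "(\<lambda>z. F z / z) holomorphic_on T"
    using assms(3) by (auto simp: T_def intro!: holomorphic_intros elim: holomorphic_on_subset)
  have oT: "open T" using \<open>open S\<close> by (auto simp: T_def)
  have "contour_integral g (\<lambda>z. F z / z) = contour_integral (\<lambda>t. q * g t) (\<lambda>z. F z / z)"
    by (rule Cauchy_theorem_homotopic_loops[OF hom oT FT vg vq])
  also have "\<dots> = contour_integral g (\<lambda>w. deriv ((*) q) w * (F (q * w) / (q * w)))"
    unfolding comp by (subst contour_integral_comp_analyticW[OF an vg]) auto
  also have "\<dots> = contour_integral g (\<lambda>z. F (q * z) / z)"
    using \<open>q \<noteq> 0\<close> by simp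
  finally show ?thesis
    by (simp add: circle_mean_conv_contour_integral g_def)
qed

lemma circle_mean_cong:
  assumes "\<And>z. norm z = 1 \<Longrightarrow> F z = G z"
  shows "circle_mean F = circle_mean G"
  using assms by (simp add: circle_mean_def)

lemma continuous_on_cis_imp_integrable:
  fixes F :: "complex \<Rightarrow> complex"
  assumes "continuous_on (sphere 0 1) F"
  shows "(\<lambda>\<theta>. F (cis \<theta>)) integrable_on {-pi..pi}"
proof (rule integrable_continuous_interval)
  show "continuous_on {-pi..pi} (\<lambda>\<theta>. F (cis \<theta>))"
    by (intro continuous_on_compose2[OF assms] continuous_intros) auto
qed

lemma circle_mean_add:
  assumes "continuous_on (sphere 0 1) F" "continuous_on (sphere 0 1) G"
  shows "circle_mean (\<lambda>z. F z + G z) = circle_mean F + circle_mean G"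
  using assms[THEN continuous_on_cis_imp_integrable]
  by (simp add: circle_mean_def Henstock_Kurzweil_Integration.integral_add algebra_simps)

lemma circle_mean_cmult: "circle_mean (\<lambda>z. c * F z) = c * circle_mean F"
  by (simp add: circle_mean_def)

lemma circle_mean_lincomb3:
  assumes "continuous_on (sphere 0 1) F" "continuous_on (sphere 0 1) G" "continuous_on (sphere 0 1) H"
  shows "circle_mean (\<lambda>z. s * F z + (t * G z + u * H z))
       = s * circle_mean F + (t * circle_mean G + u * circle_mean H)"
  using assms by (simp add: circle_mean_add circle_mean_cmult continuous_on_add continuous_on_mult_left)

lemma circle_mean_sum:
  assumes "finite I" "\<And>i. i \<in> I \<Longrightarrow> continuous_on (sphere 0 1) (F i)"
  shows "circle_mean (\<lambda>z. \<Sum>i\<in>I. F i z) = (\<Sum>i\<in>I. circle_mean (F i))"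
  using assms
  by (simp add: circle_mean_def integral_sum continuous_on_cis_imp_integrable sum_distrib_left)

lemma circle_mean_bound:
  assumes "continuous_on (sphere 0 1) F" "\<And>z. norm z = 1 \<Longrightarrow> norm (F z) \<le> B"
  shows "norm (circle_mean F) \<le> B"
proof -
  have "norm (integral {-pi..pi} (\<lambda>\<theta>. F (cis \<theta>))) \<le> B * (pi - (-pi))"
    using assms(2) by (intro integral_bound continuous_on_compose2[OF assms(1)] continuous_intros) auto
  then show ?thesis by (simp add: circle_mean_def norm_divide divide_simps)
qed

lemma circle_mean_const [simp]: "circle_mean (\<lambda>z. c) = c"
  by (simp add: circle_mean_def scaleR_conv_of_real)

lemma circle_mean_reflect: "circle_mean (\<lambda>z. F (1 / z)) = circle_mean F"
proof -
  have "1 / cis \<theta> = cis (- \<theta>)" for \<theta>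
    by (metis cis_inverse inverse_eq_divide)
  then show ?thesis
    unfolding circle_mean_def
    using Henstock_Kurzweil_Integration.integral_reflect_real[of pi "-pi" "\<lambda>\<theta>. F (cis \<theta>)"]
    by simp
qed

text \<open>The mean over arbitrarily small circles is the same, and tends to \<open>F 0\<close>.\<close>
lemma circle_mean_holomorphic_disc:
  assumes F: "F holomorphic_on S" "open S" and S: "cball 0 1 \<subseteq> S"
  shows "circle_mean F = F 0"
proof -
  have cont: "continuous_on (cball 0 1) F"
    using F(1) S holomorphic_on_imp_continuous_on continuous_on_subset by blast
  have small: "norm (circle_mean F - F 0) \<le> e" if "e > 0" for e
  proof -
    from cont have "isCont F 0"
      by (rule continuous_on_interior) auto
    then obtain s where s: "s > 0" "\<And>z. norm z < s \<Longrightarrow> norm (F z - F 0) < e"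
      using \<open>e > 0\<close> by (auto simp: continuous_at_eps_delta dist_norm)
    define t where "t = min (1/2) (s / 2)"
    have t: "t > 0" "t < 1" "t < s" using s(1) by (auto simp: t_def)
    have dilated: "circle_mean F = circle_mean (\<lambda>z. F (of_real t * z))"
    proof (rule circle_mean_dilate[of "of_real t" F S, symmetric])
      show "of_real t \<noteq> (0 :: complex)" "norm (of_real t :: complex) < 1" using t by simp_all
    qed (use F S in auto)
    have cont_t: "continuous_on (sphere 0 1) (\<lambda>z. F (of_real t * z))"
    proof (rule continuous_on_compose2[OF cont])
      show "(\<lambda>z :: complex. of_real t * z) ` sphere 0 1 \<subseteq> cball 0 1"
        using t by (auto simp: norm_mult dist_norm)
    qed (intro continuous_intros)
    have "circle_mean F - F 0 = circle_mean (\<lambda>z. F (of_real t * z) + (- F 0))"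
      by (subst circle_mean_add[OF cont_t continuous_on_const]) (simp add: dilated)
    also have "norm \<dots> \<le> e"
    proof (rule circle_mean_bound)
      show "continuous_on (sphere 0 1) (\<lambda>z. F (of_real t * z) + (- F 0))"
        by (intro continuous_on_add cont_t continuous_on_const)
      fix z :: complex assume "norm z = 1"
      then have "norm (of_real t * z) < s" using t by (simp add: norm_mult)
      from s(2)[OF this] show "norm (F (of_real t * z) + (- F 0)) \<le> e" by simp
    qed
    finally show ?thesis .
  qed
  show ?thesis
    using field_le_epsilon[of "norm (circle_mean F - F 0)" 0] small by auto
qed

section \<open>The Askey--Roy integral\<close>

text \<open>The Askey--Roy weight without its theta functions.\<close>
definition AR_kernel :: "complex \<Rightarrow> complex \<Rightarrow> complex \<Rightarrow> complex \<Rightarrow> complex \<Rightarrow> complex \<Rightarrow> complex" where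
  "AR_kernel q a b c d z =
     1 / (qpoch_inf q (a * z) * qpoch_inf q (b * z) * qpoch_inf q (c / z) * qpoch_inf q (d / z))"

text \<open>The functional equation says that \<open>N\<close> is a theta function of order two.  Stating the integral evaluation for
  all solutions, and not just for products of two theta functions, makes it stable under \<open>N \<mapsto> z N\<close>, which the
  iteration over \<open>c\<close> needs.\<close>
definition theta_numerator :: "complex \<Rightarrow> complex \<Rightarrow> complex \<Rightarrow> (complex \<Rightarrow> complex) \<Rightarrow> bool" where
  "theta_numerator q c d N \<longleftrightarrow>
     N holomorphic_on - {0} \<and> (\<forall>z. z \<noteq> 0 \<longrightarrow> q * z\<^sup>2 * N (q * z) = c * d * N z)"

lemma theta_numerator_shift:
  assumes "theta_numerator q c d N"
  shows "theta_numerator q (c * q ^ j) d (\<lambda>z. z ^ j * N z)"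
  unfolding theta_numerator_def
proof (intro conjI allI impI)
  show "(\<lambda>z. z ^ j * N z) holomorphic_on - {0}"
    using assms by (auto simp: theta_numerator_def intro!: holomorphic_intros)
  fix z :: complex assume "z \<noteq> 0"
  then have "q * z\<^sup>2 * N (q * z) = c * d * N z" using assms by (auto simp: theta_numerator_def)
  moreover have "q * z\<^sup>2 * ((q * z) ^ j * N (q * z)) = (q * z\<^sup>2 * N (q * z)) * (q ^ j * z ^ j)"
    by (simp only: power_mult_distrib mult_ac)
  ultimately show "q * z\<^sup>2 * ((q * z) ^ j * N (q * z)) = c * q ^ j * d * (z ^ j * N z)"
    by (simp only: mult_ac)
qed

text \<open>The annulus on which the kernel with these parameters is holomorphic; it stays between the poles that come from \<open>a, b\<close> and those that come from \<open>c, d\<close>.\<close>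
definition annulus :: "complex \<Rightarrow> complex \<Rightarrow> complex \<Rightarrow> complex \<Rightarrow> complex set" where
  "annulus a b c d = {z. norm (a * z) < 1} \<inter> {z. norm (b * z) < 1} \<inter> {z. norm c < norm z} \<inter> {z. norm d < norm z}"

lemma open_annulus: "open (annulus a b c d)"
  unfolding annulus_def by (intro open_Int open_Collect_less continuous_intros)

context
  fixes q :: complex
  assumes q0: "q \<noteq> 0" and q1: "norm q < 1"
begin

lemma qpoch_inf_div_nonzero:
  assumes "norm c < norm z"
  shows "qpoch_inf q (c / z) \<noteq> 0"
  using assms by (intro qpoch_inf_nonzero[OF q1]) (auto simp: norm_divide divide_simps)

lemma continuous_on_AR_kernel:
  assumes "norm a < 1" "norm b < 1" "norm c < 1" "norm d < 1"
  shows "continuous_on (sphere 0 1) (AR_kernel q a b c d)"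
proof -
  have "qpoch_inf q (a * z) * qpoch_inf q (b * z) * qpoch_inf q (c / z) * qpoch_inf q (d / z) \<noteq> 0"
    if "z \<in> sphere 0 1" for z
    using assms that by (auto simp: qpoch_inf_div_nonzero qpoch_inf_nonzero[OF q1] norm_mult)
  then show ?thesis
    unfolding AR_kernel_def by (intro continuous_intros continuous_on_qpoch_inf[OF q1]) auto
qed

lemma theta_numerator_continuous:
  assumes "theta_numerator q c d N"
  shows "continuous_on (sphere 0 1) N"
  using assms unfolding theta_numerator_def
  by (auto intro: continuous_on_subset[OF holomorphic_on_imp_continuous_on])

lemma holomorphic_AR_kernel: "AR_kernel q a b c d holomorphic_on annulus a b c d"
proof -
  have "z \<noteq> 0 \<and> qpoch_inf q (a * z) \<noteq> 0 \<and> qpoch_inf q (b * z) \<noteq> 0 \<and> qpoch_inf q (c / z) \<noteq> 0 \<and> qpoch_inf q (d / z) \<noteq> 0"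
    if "z \<in> annulus a b c d" for z
    using that by (auto simp: annulus_def qpoch_inf_div_nonzero qpoch_inf_nonzero[OF q1])
  then show ?thesis
    unfolding AR_kernel_def
    by (intro holomorphic_intros holomorphic_on_qpoch_inf[OF q1]) auto
qed

lemma theta_numerator_holomorphic_annulus:
  assumes "theta_numerator q c d N"
  shows "N holomorphic_on annulus a' b' c' d'"
  using assms unfolding theta_numerator_def
  by (auto elim!: holomorphic_on_subset simp: annulus_def)

lemma AR_kernel_shift_c:
  assumes "norm c < norm z"
  shows "AR_kernel q a b (c * q) d z = (1 - c / z) * AR_kernel q a b c d z"
proof -
  have "c \<noteq> z" using assms by auto
  moreover have "z \<noteq> 0" using assms by auto
  moreover have "qpoch_inf q (c / z) = (1 - c / z) * qpoch_inf q (c * q / z)"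
    by (subst qpoch_inf_rec[OF q1]) simp
  ultimately show ?thesis by (simp add: AR_kernel_def)
qed

lemma AR_kernel_commute_cd: "AR_kernel q a b c d z = AR_kernel q a b d c z"
  by (simp add: AR_kernel_def mult_ac)

text \<open>Dilation removes one factor from each of the products in \<open>a\<close> and \<open>b\<close>; in \<open>c\<close> and \<open>d\<close> it
  only restores the factor that the arguments \<open>cq\<close> and \<open>dq\<close> had dropped.\<close>
lemma AR_kernel_dilate:
  assumes "norm (a * z) < 1" "norm (b * z) < 1"
  shows "AR_kernel q a b (c * q) (d * q) (q * z) = (1 - a * z) * (1 - b * z) * AR_kernel q a b c d z"
proof -
  have "1 - a * z \<noteq> 0" "1 - b * z \<noteq> 0" using assms by auto
  moreover have "qpoch_inf q (a * z) = (1 - a * z) * qpoch_inf q (a * (q * z))"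
    "qpoch_inf q (b * z) = (1 - b * z) * qpoch_inf q (b * (q * z))"
    by (subst qpoch_inf_rec[OF q1], simp add: mult_ac)+
  ultimately show ?thesis using q0 by (simp add: AR_kernel_def mult_ac)
qed

text \<open>Moving the unit circle to radius \<open>|q|\<close> in the integral of \<open>(z - c)(z - d) N(z) W(z) / z\<close> crosses no pole,
  since the factors \<open>z - c\<close> and \<open>z - d\<close> cancel the outermost ones.  The functional equations of \<open>N\<close> and of the
  kernel turn the moved integral into that of \<open>cd (1 - az)(1 - bz) N(z) W(z) / z\<close>.  The moments of \<open>1/z\<close> cancel,
  and a linear relation between the moments of \<open>z\<close> and \<open>1\<close> is left.\<close>
lemma circle_mean_contiguous:
  assumes small: "norm a < 1" "norm b < 1" "norm c < 1" "norm d < 1"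
    and N: "theta_numerator q c d N"
  shows "(1 - a * b * c * d) * circle_mean (\<lambda>z. (z - c) * (N z * AR_kernel q a b c d z))
       = d * (1 - a * c) * (1 - b * c) * circle_mean (\<lambda>z. N z * AR_kernel q a b c d z)"
proof -
  define G where "G z = N z * AR_kernel q a b c d z" for z
  have G: "continuous_on (sphere 0 1) G"
    unfolding G_def by (intro continuous_intros continuous_on_AR_kernel theta_numerator_continuous[OF N] small)
  \<comment> \<open>This is \<open>(z - c)(z - d) N(z) W(z) / z\<close>: the factors \<open>z - c\<close> and \<open>z - d\<close> are absorbed by \<open>c \<mapsto> cq\<close>, \<open>d \<mapsto> dq\<close> in the kernel.\<close>
  define F where "F z = z * (N z * AR_kernel q a b (c * q) (d * q) z)" for z
  have F: "F holomorphic_on annulus a b (c * q) (d * q)"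
    unfolding F_def
    by (intro holomorphic_intros holomorphic_AR_kernel theta_numerator_holomorphic_annulus[OF N])
  have "circle_mean (\<lambda>z. F (q * z)) = circle_mean F"
  proof (rule circle_mean_dilate[OF q0 q1 F open_annulus])
    fix z :: complex assume z: "norm q \<le> norm z" "norm z \<le> 1"
    have "norm (c * q) < norm q" "norm (d * q) < norm q"
      using small q0 by (simp_all add: norm_mult)
    moreover have "norm (a * z) < 1" "norm (b * z) < 1"
      using small z by (auto intro!: norm_mult_less_one)
    ultimately show "z \<in> annulus a b (c * q) (d * q)" using z by (simp add: annulus_def)
  qed
  moreover have "F z = z * G z + (- (c + d) * G z + c * d * (G z / z))" if "norm z = 1" for z
  proof -
    have eq: "AR_kernel q a b (c * q) (d * q) z = (1 - c / z) * ((1 - d / z) * AR_kernel q a b c d z)"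
      using small that
      by (simp add: AR_kernel_shift_c AR_kernel_commute_cd[of a b c "d * q"] AR_kernel_commute_cd[of a b d c])
    have "z \<noteq> 0" using that by auto
    then show ?thesis unfolding F_def G_def eq by (simp add: field_simps)
  qed
  moreover have "F (q * z) = c * d * (G z / z) + (- c * d * (a + b) * G z + a * b * c * d * (z * G z))"
    if "norm z = 1" for z
  proof -
    have "z \<noteq> 0" using that by auto
    then have "q * z\<^sup>2 * N (q * z) = c * d * N z" using N by (simp add: theta_numerator_def)
    then have "q * z * N (q * z) = c * d * N z / z" using \<open>z \<noteq> 0\<close> by (simp add: field_simps power2_eq_square)
    moreover have "AR_kernel q a b (c * q) (d * q) (q * z) = (1 - a * z) * (1 - b * z) * AR_kernel q a b c d z"
      using small that by (intro AR_kernel_dilate) (auto simp: norm_mult)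
    ultimately have "F (q * z) = c * d * N z / z * ((1 - a * z) * (1 - b * z) * AR_kernel q a b c d z)"
      by (simp add: F_def mult.assoc[symmetric])
    then show ?thesis using \<open>z \<noteq> 0\<close> by (simp add: G_def field_simps)
  qed
  ultimately have shift_eq: "circle_mean (\<lambda>z. c * d * (G z / z) + (- c * d * (a + b) * G z + a * b * c * d * (z * G z)))
      = circle_mean (\<lambda>z. z * G z + (- (c + d) * G z + c * d * (G z / z)))"
    by (simp cong: circle_mean_cong)
  have "continuous_on (sphere 0 1) (\<lambda>z. G z / z)" "continuous_on (sphere 0 1) (\<lambda>z. z * G z)"
    by (auto intro!: continuous_intros G)
  note GG = this G
  have "c * d * circle_mean (\<lambda>z. G z / z)
        + (- c * d * (a + b) * circle_mean G + a * b * c * d * circle_mean (\<lambda>z. z * G z))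
      = 1 * circle_mean (\<lambda>z. z * G z) + (- (c + d) * circle_mean G + c * d * circle_mean (\<lambda>z. G z / z))"
    unfolding circle_mean_lincomb3[OF GG(1) G GG(2), symmetric] circle_mean_lincomb3[OF GG(2) G GG(1), symmetric]
    using shift_eq by (simp only: mult_1)
  moreover have "circle_mean (\<lambda>z. (z - c) * G z) = 1 * circle_mean (\<lambda>z. z * G z) + (- c * circle_mean G + 0 * circle_mean G)"
    using GG
    by (subst circle_mean_lincomb3[symmetric]) (simp_all add: left_diff_distrib)
  ultimately show ?thesis
    unfolding G_def[symmetric] by algebra
qed

text \<open>Multiplication by \<open>z - c q^j\<close> is the passage from \<open>j\<close> to \<open>j + 1\<close>, so each step is a contiguous relation.\<close>
lemma circle_mean_iterate:
  assumes small: "norm a < 1" "norm b < 1" "norm c < 1" "norm d < 1"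
    and N: "theta_numerator q c d N"
  shows "qpoch q (a * b * c * d) j * circle_mean (\<lambda>z. z ^ j * N z * AR_kernel q a b (c * q ^ j) d z)
       = d ^ j * qpoch q (a * c) j * qpoch q (b * c) j * circle_mean (\<lambda>z. N z * AR_kernel q a b c d z)"
proof (induction j)
  case 0
  show ?case by simp
next
  case (Suc j)
  have cj: "norm (c * q ^ j) < 1" using norm_mult_power_less_one small q1 by blast
  let ?I = "\<lambda>j. circle_mean (\<lambda>z. z ^ j * N z * AR_kernel q a b (c * q ^ j) d z)"
  have "?I (Suc j) = circle_mean (\<lambda>z. (z - c * q ^ j) * (z ^ j * N z * AR_kernel q a b (c * q ^ j) d z))"
  proof (rule circle_mean_cong)
    fix z :: complex assume z: "norm z = 1"
    then have "z \<noteq> 0" by auto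
    moreover have "c * q ^ Suc j = c * q ^ j * q" by simp
    moreover have "AR_kernel q a b (c * q ^ j * q) d z = (1 - c * q ^ j / z) * AR_kernel q a b (c * q ^ j) d z"
      using z cj by (intro AR_kernel_shift_c) auto
    ultimately have "z ^ Suc j * N z * AR_kernel q a b (c * q ^ Suc j) d z
        = (z * (1 - c * q ^ j / z)) * (z ^ j * N z * AR_kernel q a b (c * q ^ j) d z)"
      by (simp only: power_Suc mult_ac)
    also have "z * (1 - c * q ^ j / z) = z - c * q ^ j"
      using \<open>z \<noteq> 0\<close> by (simp add: field_simps)
    finally show "z ^ Suc j * N z * AR_kernel q a b (c * q ^ Suc j) d z =
        (z - c * q ^ j) * (z ^ j * N z * AR_kernel q a b (c * q ^ j) d z)" .
  qed
  with circle_mean_contiguous[OF small(1,2) cj small(4) theta_numerator_shift[OF N, of j]]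
  have "(1 - a * b * (c * q ^ j) * d) * ?I (Suc j) = d * (1 - a * (c * q ^ j)) * (1 - b * (c * q ^ j)) * ?I j"
    by simp
  moreover have "qpoch q (a * b * c * d) (Suc j) * ?I (Suc j)
      = qpoch q (a * b * c * d) j * ((1 - a * b * (c * q ^ j) * d) * ?I (Suc j))"
    by (simp add: qpoch_Suc mult_ac)
  ultimately have "qpoch q (a * b * c * d) (Suc j) * ?I (Suc j)
      = d * (1 - a * (c * q ^ j)) * (1 - b * (c * q ^ j)) * (qpoch q (a * b * c * d) j * ?I j)"
    by (simp add: mult_ac)
  then show ?case unfolding Suc.IH by (simp add: qpoch_Suc mult_ac)
qed

text \<open>The residue theorem for an annulus with one simple pole, at \<open>z = d\<close>.  The quotient \<open>(P z - P d) / (z - d)\<close>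
  has no pole, so its means over the two circles agree; what is subtracted is \<open>P d\<close> times
  the function \<open>z / (z - d)\<close>, whose mean is \<open>1\<close> outside and \<open>0\<close> inside \<open>|z| = |d|\<close>.\<close>
lemma circle_mean_cross_pole:
  assumes P: "P holomorphic_on S" "open S" and d: "d \<noteq> 0" "norm d < 1" and s: "0 < s" "s < 1"
    and S: "\<And>z. s * norm d \<le> norm z \<Longrightarrow> norm z \<le> 1 \<Longrightarrow> z \<in> S"
  defines "r \<equiv> complex_of_real (s * norm d)"
  shows "circle_mean (\<lambda>z. z * P z / (z - d)) = P d + circle_mean (\<lambda>z. r * z * P (r * z) / (r * z - d))"
proof -
  have r: "norm r = s * norm d" "norm r < norm d" "r \<noteq> 0" "norm r < 1"
  proof -
    show 1: "norm r = s * norm d" using s by (simp add: r_def norm_mult)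
    show "norm r < norm d" unfolding 1 using s d by simp
    then show "norm r < 1" using d by simp
    show "r \<noteq> 0" using s d by (simp add: r_def)
  qed
  have Pcont: "continuous_on S P" using P holomorphic_on_imp_continuous_on by blast
  define f where "f z = z * (if z = d then deriv P d else (P z - P d) / (z - d))" for z
  have f: "f holomorphic_on S"
    unfolding f_def by (intro holomorphic_intros pole_lemma_open P)
  have f_eq: "f z = 1 * (z * P z / (z - d)) + (- P d * (z / (z - d)) + 0 * 0)" if "z \<noteq> d" for z
    using that by (simp add: f_def diff_divide_distrib right_diff_distrib mult_ac)
  have outer: "circle_mean (\<lambda>z. z / (z - d)) = 1"
  proof -
    have "circle_mean (\<lambda>z. z / (z - d)) = circle_mean (\<lambda>z. 1 / (1 - d * (1 / z)))"
      by (intro circle_mean_cong) (auto simp: divide_simps)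
    also have "\<dots> = circle_mean (\<lambda>z. 1 / (1 - d * z))"
      by (rule circle_mean_reflect)
    also have "\<dots> = 1 / (1 - d * 0)"
    proof (rule circle_mean_holomorphic_disc)
      show "(\<lambda>z. 1 / (1 - d * z)) holomorphic_on {z. norm (d * z) < 1}"
        by (intro holomorphic_intros) auto
      show "open {z. norm (d * z) < 1}" by (intro open_Collect_less continuous_intros)
      show "cball 0 1 \<subseteq> {z. norm (d * z) < 1}"
        using d by (auto intro!: norm_mult_less_one)
    qed
    finally show ?thesis by simp
  qed
  have inner: "circle_mean (\<lambda>z. r * z / (r * z - d)) = r * 0 / (r * 0 - d)"
  proof (rule circle_mean_holomorphic_disc)
    show "(\<lambda>z. r * z / (r * z - d)) holomorphic_on {z. norm (r * z) < norm d}"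
      by (intro holomorphic_intros) auto
    show "open {z. norm (r * z) < norm d}" by (intro open_Collect_less continuous_intros)
    show "cball 0 1 \<subseteq> {z. norm (r * z) < norm d}"
    proof
      fix z :: complex assume "z \<in> cball 0 1"
      then have "norm (r * z) \<le> norm r" by (simp add: norm_mult mult_left_le)
      then show "z \<in> {z. norm (r * z) < norm d}" using r by simp
    qed
  qed
  have ne_outer: "z \<noteq> d" if "norm z = 1" for z using that d by auto
  have ne_inner: "r * z \<noteq> d" if "norm z = 1" for z
    using that r by (metis mult.right_neutral norm_mult order_less_irrefl)
  have cont_outer: "continuous_on (sphere 0 1) (\<lambda>z. z * P z / (z - d))"
    "continuous_on (sphere 0 1) (\<lambda>z. z / (z - d))"
  proof -
    have "sphere 0 1 \<subseteq> S" using S r by (auto simp: dist_norm)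
    then show "continuous_on (sphere 0 1) (\<lambda>z. z * P z / (z - d))"
      using ne_outer by (intro continuous_intros continuous_on_subset[OF Pcont]) auto
    show "continuous_on (sphere 0 1) (\<lambda>z. z / (z - d))"
      using ne_outer by (intro continuous_intros) auto
  qed
  have cont_inner: "continuous_on (sphere 0 1) (\<lambda>z. r * z * P (r * z) / (r * z - d))"
    "continuous_on (sphere 0 1) (\<lambda>z. r * z / (r * z - d))"
  proof -
    have "(\<lambda>z. r * z) ` sphere 0 1 \<subseteq> S"
      using r by (auto intro!: S simp: norm_mult)
    then show "continuous_on (sphere 0 1) (\<lambda>z. r * z * P (r * z) / (r * z - d))"
      using ne_inner by (intro continuous_intros continuous_on_compose2[OF Pcont]) auto
    show "continuous_on (sphere 0 1) (\<lambda>z. r * z / (r * z - d))"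
      using ne_inner by (intro continuous_intros) auto
  qed
  have "circle_mean (\<lambda>z. z * P z / (z - d)) - P d = circle_mean f"
  proof -
    have "circle_mean f = circle_mean (\<lambda>z. 1 * (z * P z / (z - d)) + (- P d * (z / (z - d)) + 0 * 0))"
      by (intro circle_mean_cong f_eq ne_outer)
    then show ?thesis
      by (subst (asm) circle_mean_lincomb3) (use cont_outer outer in auto)
  qed
  also have "circle_mean f = circle_mean (\<lambda>z. f (r * z))"
    using r S by (intro circle_mean_dilate[symmetric, of r f S] f P) auto
  also have "\<dots> = circle_mean (\<lambda>z. r * z * P (r * z) / (r * z - d))"
  proof -
    have "circle_mean (\<lambda>z. f (r * z)) = circle_mean (\<lambda>z. 1 * (r * z * P (r * z) / (r * z - d))
        + (- P d * (r * z / (r * z - d)) + 0 * 0))"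
      by (intro circle_mean_cong f_eq ne_inner)
    then show ?thesis
      by (subst (asm) circle_mean_lincomb3) (use cont_inner inner in auto)
  qed
  finally show ?thesis by (simp add: algebra_simps)
qed

text \<open>On a circle of radius \<open>s |d|\<close> with \<open>|q| < s < 1\<close> the factor \<open>(z/d)^j\<close> has modulus \<open>s^j\<close>, while the poles
  at \<open>c q\<^bsup>j+i\<^esup>\<close> have shrunk inside for large \<open>j\<close> and those at \<open>d q\<^bsup>i+1\<^esup>\<close> lie inside anyway.  Moving the unit
  circle there thus leaves the residue at \<open>z = d\<close> and an error of order \<open>s^j\<close>.\<close>
lemma circle_mean_limit:
  assumes small: "norm a < 1" "norm b < 1" "norm c < 1" "norm d < 1" and d: "d \<noteq> 0"
    and N: "theta_numerator q c d N"
  shows "(\<lambda>j. circle_mean (\<lambda>z. z ^ j * N z * AR_kernel q a b (c * q ^ j) d z) / d ^ j)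
     \<longlonglongrightarrow> N d / (qpoch_inf q q * qpoch_inf q (a * d) * qpoch_inf q (b * d))"
proof -
  obtain s where s: "norm q < s" "s < 1" using q1 dense by blast
  have s0: "0 < s" using s(1) norm_ge_zero[of q] by linarith
  define r where "r = complex_of_real (s * norm d)"
  have r: "norm r = s * norm d" "norm r < norm d" "r \<noteq> 0" "norm r < 1" "norm (d * q) < norm r"
  proof -
    show 1: "norm r = s * norm d" using s0 by (simp add: r_def norm_mult)
    show "norm r < norm d" unfolding 1 using s d by simp
    then show "norm r < 1" using small by simp
    show "r \<noteq> 0" using s0 d by (simp add: r_def)
    show "norm (d * q) < norm r" unfolding 1 using s d by (simp add: norm_mult)
  qed
  \<comment> \<open>The \<open>j\<close>-th integrand is \<open>z P j z / (z - d)\<close>: the pole at \<open>d\<close> has been split off.\<close>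
  define P where "P j z = (z / d) ^ j * (N z * AR_kernel q a b (c * q ^ j) (d * q) z)" for j z
  define E where "E j = circle_mean (\<lambda>z. r * z * P j (r * z) / (r * z - d))" for j
  have "(\<lambda>j. c * q ^ j / r) \<longlonglongrightarrow> c * 0 / r"
    using q1 by (intro tendsto_intros LIMSEQ_power_zero) (use r in auto)
  then have "(\<lambda>j. c * q ^ j / r) \<longlonglongrightarrow> 0" by simp
  from tendstoD[OF this, of "1/2"]
  have "eventually (\<lambda>j. norm (c * q ^ j / r) < 1/2) sequentially"
    by simp
  then have ev: "eventually (\<lambda>j. norm (c * q ^ j) < norm r / 2) sequentially"
    by eventually_elim (use r(3) in \<open>simp add: norm_divide field_simps\<close>)
  have in_annulus: "z \<in> annulus a b (c * q ^ j) (d * q)"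
    if "norm (c * q ^ j) < norm r / 2" "norm r \<le> norm z" "norm z \<le> 1" for z j
  proof -
    have "norm (a * z) < 1" "norm (b * z) < 1"
      using small that by (auto intro!: norm_mult_less_one)
    moreover have "norm (c * q ^ j) < norm z"
      using that norm_ge_zero[of "c * q ^ j"] by linarith
    ultimately show ?thesis using that r unfolding annulus_def by auto
  qed
  have P: "P j holomorphic_on annulus a b (c * q ^ j) (d * q)" for j
    unfolding P_def using d
    by (intro holomorphic_intros holomorphic_AR_kernel theta_numerator_holomorphic_annulus[OF N])
  have step: "circle_mean (\<lambda>z. z ^ j * N z * AR_kernel q a b (c * q ^ j) d z) / d ^ j = P j d + E j"
    if j: "norm (c * q ^ j) < norm r / 2" for j
  proof -
    have "circle_mean (\<lambda>z. z ^ j * N z * AR_kernel q a b (c * q ^ j) d z) / d ^ j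
        = circle_mean (\<lambda>z. (1 / d ^ j) * (z ^ j * N z * AR_kernel q a b (c * q ^ j) d z))"
      by (subst circle_mean_cmult) simp
    also have "\<dots> = circle_mean (\<lambda>z. z * P j z / (z - d))"
    proof (rule circle_mean_cong)
      fix z :: complex assume z: "norm z = 1"
      then have "z \<noteq> 0" "z \<noteq> d" using small by auto
      have "AR_kernel q a b (c * q ^ j) (d * q) z = (1 - d / z) * AR_kernel q a b (c * q ^ j) d z"
        using AR_kernel_shift_c[of d z a b "c * q ^ j"] z small by (simp add: AR_kernel_commute_cd)
      then have "z * AR_kernel q a b (c * q ^ j) (d * q) z = (z - d) * AR_kernel q a b (c * q ^ j) d z"
        using \<open>z \<noteq> 0\<close> by (simp add: field_simps)
      then have "z * AR_kernel q a b (c * q ^ j) (d * q) z / (z - d) = AR_kernel q a b (c * q ^ j) d z"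
        using \<open>z \<noteq> d\<close> by simp
      then show "(1 / d ^ j) * (z ^ j * N z * AR_kernel q a b (c * q ^ j) d z) = z * P j z / (z - d)"
        by (simp add: P_def power_divide mult_ac flip: \<open>_ = AR_kernel q a b (c * q ^ j) d z\<close>)
    qed
    also have "\<dots> = P j d + E j"
      unfolding E_def r_def
      by (rule circle_mean_cross_pole[OF P open_annulus d small(4) s0 s(2)])
         (use in_annulus j r in auto)
    finally show ?thesis .
  qed
  have lim_P: "(\<lambda>j. P j d) \<longlonglongrightarrow> N d / (qpoch_inf q q * qpoch_inf q (a * d) * qpoch_inf q (b * d))"
  proof -
    have "isCont (qpoch_inf q) 0"
      using holomorphic_on_imp_continuous_on[OF holomorphic_qpoch_inf_UNIV[OF q1]]
      by (simp add: continuous_on_eq_continuous_at)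
    moreover have "(\<lambda>j. c * q ^ j / d) \<longlonglongrightarrow> c * 0 / d"
      using q1 by (intro tendsto_intros LIMSEQ_power_zero) (use d in auto)
    then have "(\<lambda>j. c * q ^ j / d) \<longlonglongrightarrow> 0" by simp
    ultimately have "(\<lambda>j. qpoch_inf q (c * q ^ j / d)) \<longlonglongrightarrow> qpoch_inf q 0"
      by (rule isCont_tendsto_compose)
    then have lim: "(\<lambda>j. qpoch_inf q (c * q ^ j / d)) \<longlonglongrightarrow> 1" using q1 by simp
    have nz: "qpoch_inf q q \<noteq> 0" "qpoch_inf q (a * d) \<noteq> 0" "qpoch_inf q (b * d) \<noteq> 0"
      using small q1 by (auto intro!: qpoch_inf_nonzero[OF q1] norm_mult_less_one)
    have "(\<lambda>j. N d / (qpoch_inf q (a * d) * qpoch_inf q (b * d) * qpoch_inf q (c * q ^ j / d) * qpoch_inf q q))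
        \<longlonglongrightarrow> N d / (qpoch_inf q (a * d) * qpoch_inf q (b * d) * 1 * qpoch_inf q q)"
      using nz by (intro tendsto_intros lim) auto
    then show ?thesis using d by (simp add: P_def AR_kernel_def mult_ac)
  qed
  \<comment> \<open>The error is \<open>s^j\<close> times \<open>W\<close>, which does not depend on \<open>j\<close>, times the reciprocal product in \<open>c q^j / (r z)\<close>; that argument is at most \<open>1/2\<close> in modulus, so compactness bounds both uniformly.\<close>
  define W where "W z = r * z * N (r * z) / (qpoch_inf q (a * (r * z)) * qpoch_inf q (b * (r * z))
      * qpoch_inf q (d * q / (r * z)) * (r * z - d))" for z
  have on_inner: "norm (r * z) = norm r" "r * z \<noteq> 0" "r * z \<noteq> d" if "norm z = 1" for z
  proof -
    show "norm (r * z) = norm r" using that by (simp add: norm_mult)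
    then show "r * z \<noteq> d" "r * z \<noteq> 0" using r by auto
  qed
  have W: "continuous_on (sphere 0 1) W"
  proof -
    have "qpoch_inf q (a * (r * z)) \<noteq> 0 \<and> qpoch_inf q (b * (r * z)) \<noteq> 0 \<and>
        qpoch_inf q (d * q / (r * z)) \<noteq> 0 \<and> r * z \<noteq> 0 \<and> r * z \<noteq> d" if "z \<in> sphere 0 1" for z
    proof -
      have "norm z = 1" using that by simp
      note on_inner[OF this]
      moreover have "norm (a * (r * z)) < 1" "norm (b * (r * z)) < 1"
        using small r calculation(1) by (auto intro!: norm_mult_less_one)
      ultimately show ?thesis
        using r by (auto intro!: qpoch_inf_nonzero[OF q1] qpoch_inf_div_nonzero)
    qed
    then have nz: "\<forall>z\<in>sphere 0 1. qpoch_inf q (a * (r * z)) * qpoch_inf q (b * (r * z))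
        * qpoch_inf q (d * q / (r * z)) * (r * z - d) \<noteq> 0"
      by (simp only: mult_eq_0_iff right_minus_eq) blast
    have "continuous_on (- {0}) N"
      using N by (auto simp: theta_numerator_def intro: holomorphic_on_imp_continuous_on)
    then have cont_N: "continuous_on (sphere 0 1) (\<lambda>z. N (r * z))"
      by (rule continuous_on_compose2) (use r in \<open>auto intro!: continuous_intros\<close>)
    have cont_rz: "continuous_on (sphere 0 1) (\<lambda>z. r * z)" by (intro continuous_intros)
    have "continuous_on (sphere 0 1) (\<lambda>z. d * q / (r * z))"
      by (intro continuous_intros) (use r in auto)
    then show ?thesis
      unfolding W_def
      by (intro continuous_on_divide[OF _ _ nz] continuous_on_mult continuous_on_diff continuous_on_const
          continuous_on_qpoch_inf[OF q1] cont_N cont_rz)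
  qed
  obtain B1 where "\<forall>z\<in>sphere 0 1. norm (W z) \<le> B1"
    using compact_imp_bounded[OF compact_continuous_image[OF W compact_sphere]]
    by (auto simp: bounded_iff)
  then have B1: "norm (W z) \<le> B1" if "norm z = 1" for z
    using that by simp
  have "continuous_on (cball 0 (1/2)) (\<lambda>x. 1 / qpoch_inf q x)"
    by (intro continuous_intros continuous_on_qpoch_inf[OF q1]) (auto intro!: qpoch_inf_nonzero[OF q1])
  from compact_imp_bounded[OF compact_continuous_image[OF this compact_cball]]
  obtain B2 where "\<forall>x\<in>cball 0 (1/2). norm (1 / qpoch_inf q x) \<le> B2"
    by (auto simp: bounded_iff)
  then have B2: "norm (1 / qpoch_inf q x) \<le> B2" if "norm x \<le> 1/2" for x
    using that by simp
  have bound: "norm (E j) \<le> s ^ j * (B1 * B2)" if j: "norm (c * q ^ j) < norm r / 2" for j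
    unfolding E_def
  proof (rule circle_mean_bound)
    have "continuous_on (annulus a b (c * q ^ j) (d * q)) (P j)"
      using P holomorphic_on_imp_continuous_on by blast
    moreover have "(\<lambda>z. r * z) ` sphere 0 1 \<subseteq> annulus a b (c * q ^ j) (d * q)"
      using on_inner r by (auto intro!: in_annulus j)
    ultimately have "continuous_on (sphere 0 1) (\<lambda>z. P j (r * z))"
      by (intro continuous_on_compose2[of _ "P j" _ "\<lambda>z. r * z"] continuous_intros)
    then show "continuous_on (sphere 0 1) (\<lambda>z. r * z * P j (r * z) / (r * z - d))"
      by (intro continuous_intros) (use on_inner in auto)
    fix z :: complex assume z: "norm z = 1"
    have "norm (c * q ^ j / (r * z)) = norm (c * q ^ j) / norm r"
      using z by (simp add: norm_divide norm_mult)
    also have "\<dots> \<le> 1/2"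
      using j r(3) by (simp add: field_simps)
    finally have "norm (c * q ^ j / (r * z)) \<le> 1/2" .
    note B2[OF this]
    moreover have "norm ((r * z / d) ^ j) = s ^ j"
      using d z r s0 by (simp add: norm_power norm_divide norm_mult)
    moreover have "r * z * P j (r * z) / (r * z - d) = (r * z / d) ^ j * (W z * (1 / qpoch_inf q (c * q ^ j / (r * z))))"
      by (simp add: P_def W_def AR_kernel_def mult_ac)
    ultimately show "norm (r * z * P j (r * z) / (r * z - d)) \<le> s ^ j * (B1 * B2)"
      using B1[OF z] s0 order_trans[OF norm_ge_zero B1[OF z]]
      by (simp only: norm_mult) (intro mult_left_mono mult_mono, auto)
  qed
  have "E \<longlonglongrightarrow> 0"
  proof (rule Lim_null_comparison)
    show "eventually (\<lambda>j. norm (E j) \<le> s ^ j * (B1 * B2)) sequentially"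
      using ev by eventually_elim (rule bound)
    have "(\<lambda>j. s ^ j * (B1 * B2)) \<longlonglongrightarrow> 0 * (B1 * B2)"
      using s s0 by (intro tendsto_intros LIMSEQ_power_zero) auto
    then show "(\<lambda>j. s ^ j * (B1 * B2)) \<longlonglongrightarrow> 0" by simp
  qed
  from tendsto_add[OF lim_P this]
  have "(\<lambda>j. P j d + E j) \<longlonglongrightarrow> N d / (qpoch_inf q q * qpoch_inf q (a * d) * qpoch_inf q (b * d))"
    by simp
  moreover have "eventually (\<lambda>j. P j d + E j =
      circle_mean (\<lambda>z. z ^ j * N z * AR_kernel q a b (c * q ^ j) d z) / d ^ j) sequentially"
    using ev by eventually_elim (simp add: step)
  ultimately show ?thesis by (rule Lim_transform_eventually)
qed

text \<open>Compare the two limits of \<open>(abcd; q)\<^sub>j\<close> times the \<open>j\<close>-th mean: one comes from the contiguous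
  relation, the other from the residue.\<close>
theorem Askey_Roy_integral:
  assumes small: "norm a < 1" "norm b < 1" "norm c < 1" "norm d < 1" and d: "d \<noteq> 0"
    and N: "theta_numerator q c d N"
  shows "circle_mean (\<lambda>z. N z * AR_kernel q a b c d z) = qpoch_inf q (a * b * c * d) * N d /
     (qpoch_inf q q * qpoch_inf q (a * c) * qpoch_inf q (a * d) * qpoch_inf q (b * c) * qpoch_inf q (b * d))"
proof -
  define M where "M = circle_mean (\<lambda>z. N z * AR_kernel q a b c d z)"
  define X where "X j = circle_mean (\<lambda>z. z ^ j * N z * AR_kernel q a b (c * q ^ j) d z) / d ^ j" for j
  have X: "qpoch q (a * b * c * d) j * X j = qpoch q (a * c) j * qpoch q (b * c) j * M" for j
    using circle_mean_iterate[OF small N, of j] d by (simp add: X_def M_def field_simps)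
  have "(\<lambda>j. qpoch q (a * b * c * d) j * X j) \<longlonglongrightarrow>
      qpoch_inf q (a * b * c * d) * (N d / (qpoch_inf q q * qpoch_inf q (a * d) * qpoch_inf q (b * d)))"
    unfolding X_def
    by (intro tendsto_mult qpoch_tendsto_qpoch_inf[OF q1] circle_mean_limit[OF small d N])
  moreover have "(\<lambda>j. qpoch q (a * b * c * d) j * X j) \<longlonglongrightarrow> qpoch_inf q (a * c) * qpoch_inf q (b * c) * M"
    unfolding X by (intro tendsto_intros qpoch_tendsto_qpoch_inf[OF q1])
  ultimately have "qpoch_inf q (a * c) * qpoch_inf q (b * c) * M
      = qpoch_inf q (a * b * c * d) * (N d / (qpoch_inf q q * qpoch_inf q (a * d) * qpoch_inf q (b * d)))"
    by (metis LIMSEQ_unique)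
  moreover have "qpoch_inf q (a * c) \<noteq> 0" "qpoch_inf q (b * c) \<noteq> 0"
    using small by (auto intro!: qpoch_inf_nonzero[OF q1] norm_mult_less_one)
  then have "M = qpoch_inf q (a * c) * qpoch_inf q (b * c) * M / (qpoch_inf q (a * c) * qpoch_inf q (b * c))"
    by simp
  ultimately show ?thesis
    unfolding M_def[symmetric] by (simp add: mult_ac)
qed

end

section \<open>A q-difference operator and terminating sums\<close>

text \<open>The operator \<open>\<Prod>\<^sub>i\<^sub><\<^sub>n (1 - q\<^bsup>-i\<^esup> T)\<close> with \<open>T p(x) = p(qx)\<close>.  Since \<open>T x^i = q^i x^i\<close>, the factors
  annihilate \<open>1, x, \<dots>, x\<^bsup>n-1\<^esup>\<close>.\<close>
primrec qdiff :: "complex \<Rightarrow> nat \<Rightarrow> (complex \<Rightarrow> complex) \<Rightarrow> complex \<Rightarrow> complex" where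
  "qdiff q 0 p = p"
| "qdiff q (Suc n) p = (\<lambda>x. qdiff q n p x - qdiff q n p (q * x) / q ^ n)"

text \<open>Only the points \<open>q^k x\<close> with \<open>k \<le> n\<close> are seen by the operator, so identities between rational functions
  may be used although they fail at the pole, where division returns \<open>0\<close>.\<close>
lemma qdiff_cong:
  assumes "\<And>k. k \<le> n \<Longrightarrow> p (q ^ k * x) = r (q ^ k * x)"
  shows "qdiff q n p x = qdiff q n r x"
  using assms
proof (induction n arbitrary: x)
  case 0
  then show ?case using 0[of 0] by simp
next
  case (Suc n)
  have "qdiff q n p x = qdiff q n r x"
    using Suc.prems by (intro Suc.IH) auto
  moreover have "qdiff q n p (q * x) = qdiff q n r (q * x)"
  proof (rule Suc.IH)
    fix k assume "k \<le> n"
    then show "p (q ^ k * (q * x)) = r (q ^ k * (q * x))"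
      using Suc.prems[of "Suc k"] by (simp add: mult_ac)
  qed
  ultimately show ?case by simp
qed

lemma qdiff_add: "qdiff q n (\<lambda>x. p x + r x) x = qdiff q n p x + qdiff q n r x"
  by (induction n arbitrary: x) (simp_all add: add_divide_distrib)

lemma qdiff_cmult: "qdiff q n (\<lambda>x. c * p x) x = c * qdiff q n p x"
  by (induction n arbitrary: x) (simp_all add: algebra_simps)

context
  fixes q :: complex
  assumes q0: "q \<noteq> 0" and q1: "norm q < 1"
begin

text \<open>Conjugating by \<open>x\<close> replaces \<open>T\<close> by \<open>q T\<close>, which shifts the indices \<open>i\<close> of the product: the factors
  \<open>1 - q\<^bsup>1-i\<^esup> T\<close> for \<open>i \<le> n\<close> are those of the operator of order \<open>n\<close> and the additional factor \<open>1 - q T\<close>.\<close>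
lemma qdiff_times_x:
  "qdiff q (Suc n) (\<lambda>x. x * p x) x = x * (qdiff q n p x - q * qdiff q n p (q * x))"
proof (induction n arbitrary: x)
  case 0
  show ?case by (simp add: algebra_simps)
next
  case (Suc n)
  have "qdiff q (Suc (Suc n)) (\<lambda>x. x * p x) x =
        x * (qdiff q n p x - q * qdiff q n p (q * x))
        - q * x * (qdiff q n p (q * x) - q * qdiff q n p (q * (q * x))) / q ^ Suc n"
    by (subst qdiff.simps(2)) (simp only: Suc.IH)
  also have "\<dots> = x * (qdiff q (Suc n) p x - q * qdiff q (Suc n) p (q * x))"
    using q0 by (simp add: field_simps)
  finally show ?case .
qed

lemma qdiff_const: "0 < n \<Longrightarrow> qdiff q n (\<lambda>x. c) x = 0"
proof (induction n arbitrary: x)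
  case (Suc n)
  show ?case
  proof (cases "n = 0")
    case False
    then show ?thesis by (simp only: qdiff.simps Suc.IH) simp
  qed simp
qed simp

lemma qdiff_power_eq_0: "i < n \<Longrightarrow> qdiff q n (\<lambda>x. x ^ i) x = 0"
proof (induction i arbitrary: n x)
  case 0
  then show ?case by (simp add: qdiff_const)
next
  case (Suc i)
  then obtain m where m: "n = Suc m" "i < m" by (cases n) auto
  show ?case
    unfolding m power_Suc qdiff_times_x using Suc.IH[OF m(2)] by simp
qed

lemma qdiff_qpoch_eq_0:
  assumes "i + j + l < n"
  shows "qdiff q n (\<lambda>x. x ^ i * qpoch q (A * x) j * qpoch q (B * x) l) x = 0"
  using assms
proof (induction j arbitrary: i l)
  case (Suc j)
  have eq: "(\<lambda>x. x ^ i * qpoch q (A * x) (Suc j) * qpoch q (B * x) l) =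
     (\<lambda>x. x ^ i * qpoch q (A * x) j * qpoch q (B * x) l
        + (- A * q ^ j) * (x ^ Suc i * qpoch q (A * x) j * qpoch q (B * x) l))"
    by (simp add: fun_eq_iff qpoch_Suc algebra_simps)
  show ?case unfolding eq qdiff_add qdiff_cmult
    using Suc.IH[of i l] Suc.IH[of "Suc i" l] Suc.prems by simp
next
  case 0
  then show ?case
  proof (induction l arbitrary: i)
    case 0
    then show ?case by (simp add: qdiff_power_eq_0)
  next
    case (Suc l)
    have eq: "(\<lambda>x. x ^ i * qpoch q (A * x) 0 * qpoch q (B * x) (Suc l)) =
       (\<lambda>x. x ^ i * qpoch q (A * x) 0 * qpoch q (B * x) l
          + (- B * q ^ l) * (x ^ Suc i * qpoch q (A * x) 0 * qpoch q (B * x) l))"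
      by (simp add: fun_eq_iff qpoch_Suc algebra_simps)
    show ?case unfolding eq qdiff_add qdiff_cmult
      using Suc.IH[of i] Suc.IH[of "Suc i"] Suc.prems by simp
  qed
qed

text \<open>By \<open>qdiff_times_x\<close> the claim for \<open>n + 1\<close> is a difference of two values for \<open>n\<close>, whose denominators share all but
  their outermost factors.\<close>
lemma qdiff_power_over_linear:
  assumes "\<And>k. k \<le> n \<Longrightarrow> B * x * q ^ k \<noteq> 1"
  shows "qdiff q n (\<lambda>x. x ^ n / (1 - B * x)) x = x ^ n * qpoch q q n / qpoch q (B * x) (Suc n)"
  using assms
proof (induction n arbitrary: x)
  case 0
  then show ?case by (simp add: qpoch_Suc)
next
  case (Suc n)
  have 1: "qdiff q n (\<lambda>x. x ^ n / (1 - B * x)) x = x ^ n * qpoch q q n / qpoch q (B * x) (Suc n)"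
    using Suc.prems by (intro Suc.IH) auto
  have 2: "qdiff q n (\<lambda>x. x ^ n / (1 - B * x)) (q * x)
      = (q * x) ^ n * qpoch q q n / qpoch q (B * (q * x)) (Suc n)"
  proof (rule Suc.IH)
    fix k assume "k \<le> n"
    then show "B * (q * x) * q ^ k \<noteq> 1" using Suc.prems[of "Suc k"] by (simp add: mult_ac)
  qed
  define P where "P = qpoch q (B * (q * x)) n"
  have l: "1 - B * x \<noteq> 0" using Suc.prems[of 0] by simp
  have r: "1 - B * x * q ^ Suc n \<noteq> 0" using Suc.prems[of "Suc n"] by simp
  have "P \<noteq> 0"
    using Suc.prems[of "Suc _"] by (auto simp: P_def qpoch_def mult_ac)
  have e1: "qpoch q (B * x) (Suc n) = (1 - B * x) * P"
    by (simp add: qpoch_Suc_left P_def mult_ac)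
  have e2: "qpoch q (B * (q * x)) (Suc n) = P * (1 - B * x * q ^ Suc n)"
    by (simp add: qpoch_Suc P_def mult_ac)
  have e3: "qpoch q (B * x) (Suc (Suc n)) = (1 - B * x) * P * (1 - B * x * q ^ Suc n)"
    by (subst qpoch_Suc) (simp only: e1)
  have e4: "qpoch q q (Suc n) = qpoch q q n * (1 - q ^ Suc n)"
    by (simp add: qpoch_Suc)
  have "qdiff q (Suc n) (\<lambda>x. x ^ Suc n / (1 - B * x)) x
      = x * (qdiff q n (\<lambda>x. x ^ n / (1 - B * x)) x - q * qdiff q n (\<lambda>x. x ^ n / (1 - B * x)) (q * x))"
    by (subst qdiff_times_x[symmetric]) simp
  also have "\<dots> = x ^ Suc n * qpoch q q n * (1 / ((1 - B * x) * P) - q ^ Suc n / (P * (1 - B * x * q ^ Suc n)))"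
    unfolding 1 2 e1 e2 by (simp add: power_mult_distrib algebra_simps)
  also have "1 / ((1 - B * x) * P) - q ^ Suc n / (P * (1 - B * x * q ^ Suc n))
     = (1 - q ^ Suc n) / ((1 - B * x) * P * (1 - B * x * q ^ Suc n))"
  proof -
    have "1 / (u * P) - s / (P * v) = (1 - s) / (u * P * v)"
      if "u \<noteq> 0" "v \<noteq> 0" "v - s * u = 1 - s" for u v s :: complex
    proof -
      have "1 / (u * P) - s / (P * v) = (v - s * u) / (u * P * v)"
        using that \<open>P \<noteq> 0\<close> by (simp add: field_simps)
      then show ?thesis using that by simp
    qed
    from this[OF l r] show ?thesis by (simp add: algebra_simps)
  qed
  finally show ?case unfolding e3 e4 by (simp only: times_divide_eq_right mult.assoc)
qed

text \<open>One factor at a time, \<open>1 - Aq^jx\<close> divided by \<open>1 - Bx\<close> equals \<open>1 + (B - Aq^j) x / (1 - Bx)\<close>, and the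
  polynomial part has degree below \<open>n\<close>.  Padding by \<open>x\<^bsup>n-j\<^esup>\<close> makes the induction start from
  \<open>x^n / (1 - Bx)\<close>, which avoids dividing by \<open>B\<close>: the value \<open>B = abcdq\<^bsup>n-1\<^esup>\<close> used later vanishes when \<open>b = 0\<close>.\<close>
lemma qdiff_qpoch_over_linear_aux:
  assumes "\<And>k. k \<le> n \<Longrightarrow> B * x * q ^ k \<noteq> 1" and "j \<le> n"
  shows "qdiff q n (\<lambda>x. x ^ (n - j) * qpoch q (A * x) j / (1 - B * x)) x
       = x ^ n * qpoch q q n * (\<Prod>i<j. B - A * q ^ i) / qpoch q (B * x) (Suc n)"
  using assms(2)
proof (induction j)
  case 0
  then show ?case using qdiff_power_over_linear[of n B x] assms(1) by simp
next
  case (Suc j)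
  define m where "m = n - Suc j"
  have m: "n - j = Suc m" using Suc.prems by (simp add: m_def)
  have "qdiff q n (\<lambda>x. x ^ m * qpoch q (A * x) (Suc j) / (1 - B * x)) x
     = qdiff q n (\<lambda>x. x ^ m * qpoch q (A * x) j * qpoch q (0 * x) 0
        + (B - A * q ^ j) * (x ^ Suc m * qpoch q (A * x) j / (1 - B * x))) x"
  proof (rule qdiff_cong)
    fix k assume "k \<le> n"
    then have "1 - B * (q ^ k * x) \<noteq> 0" using assms(1)[of k] by (simp add: mult_ac)
    then show "(q ^ k * x) ^ m * qpoch q (A * (q ^ k * x)) (Suc j) / (1 - B * (q ^ k * x))
       = (q ^ k * x) ^ m * qpoch q (A * (q ^ k * x)) j * qpoch q (0 * (q ^ k * x)) 0 +
         (B - A * q ^ j) * ((q ^ k * x) ^ Suc m * qpoch q (A * (q ^ k * x)) j / (1 - B * (q ^ k * x)))"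
      by (simp add: qpoch_Suc field_simps)
  qed
  also have "\<dots> = (B - A * q ^ j) * qdiff q n (\<lambda>x. x ^ Suc m * qpoch q (A * x) j / (1 - B * x)) x"
    unfolding qdiff_add qdiff_cmult
    using qdiff_qpoch_eq_0[of m j 0 n A 0 x] Suc.prems by (simp add: m_def)
  finally show ?case
    using Suc by (simp add: m m_def[symmetric])
qed

lemma qdiff_qpoch_over_linear:
  assumes "\<And>k. k \<le> n \<Longrightarrow> B * x * q ^ k \<noteq> 1"
  shows "qdiff q n (\<lambda>x. qpoch q (A * x) n / (1 - B * x)) x
       = x ^ n * qpoch q q n * (\<Prod>i<n. B - A * q ^ i) / qpoch q (B * x) (Suc n)"
  using qdiff_qpoch_over_linear_aux[of n B x n A] assms by simp

lemma qpoch_inverse_power_eq_0: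
  assumes "n < k"
  shows "qpoch q (inverse (q ^ n)) k = 0"
proof -
  have "\<exists>i\<in>{..<k}. 1 - inverse (q ^ n) * q ^ i = 0"
    using assms q0 by (intro bexI[of _ n]) simp_all
  then show ?thesis unfolding qpoch_def by (intro prod_zero) simp_all
qed

lemma qpoch_q_nonzero: "qpoch q q n \<noteq> 0"
  using qpoch_nonzero[OF q1 q1] .

text \<open>The coefficients of the operator are those of the terminating basic hypergeometric series; the recursion
  over \<open>n\<close> amounts to the \<open>q\<close>-Pascal rule for them.\<close>
lemma qdiff_conv_sum:
  "qdiff q n p x = (\<Sum>k\<le>n. qpoch q (inverse (q ^ n)) k / qpoch q q k * q ^ k * p (q ^ k * x))"
proof (induction n arbitrary: x)
  case 0
  show ?case by simp
next
  case (Suc n)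
  define w where "w n k = qpoch q (inverse (q ^ n)) k / qpoch q q k * q ^ k" for n k
  have w0: "w n 0 = 1" for n by (simp add: w_def)
  have w_out: "w n (Suc n) = 0"
    by (simp add: w_def qpoch_inverse_power_eq_0)
  have w_Suc: "w (Suc n) (Suc k) = w n (Suc k) - w n k / q ^ n" for k
  proof -
    define Q where "Q = inverse (q ^ n)"
    have Q: "inverse (q ^ Suc n) * q = Q" using q0 by (simp add: Q_def)
    have nz: "1 - q ^ Suc k \<noteq> 0"
      using norm_mult_power_less_one[OF q1 q1, of k] by auto
    have e1: "qpoch q (inverse (q ^ Suc n)) (Suc k) = (1 - Q / q) * qpoch q Q k"
      unfolding qpoch_Suc_left Q using q0 by (simp add: Q_def field_simps)
    have e2: "qpoch q q (Suc k) = qpoch q q k * (1 - q ^ Suc k)"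
      by (simp add: qpoch_Suc)
    have e3: "(1 - Q / q) * X / (Y * (1 - q * t)) * (q * t) = X * (1 - Q * t) / (Y * (1 - q * t)) * (q * t) - X / Y * t * Q"
      if "Y \<noteq> 0" "1 - q * t \<noteq> 0" for X Y t
    proof -
      have "(1 - Q / q) * X / (Y * (1 - q * t)) * (q * t) = X * ((1 - Q / q) * q * t) / (Y * (1 - q * t))"
        by (simp only: times_divide_eq_left times_divide_eq_right mult_ac)
      also have "(1 - Q / q) * q = q - Q" using q0 by (simp add: field_simps)
      also have "(q - Q) * t = (1 - Q * t) * (q * t) - t * Q * (1 - q * t)"
        by (simp add: algebra_simps)
      also have "X * \<dots> / (Y * (1 - q * t)) = X * (1 - Q * t) / (Y * (1 - q * t)) * (q * t) - X / Y * t * Q"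
      proof -
        have "X * (u - v * w) / (Y * w) = X * u / (Y * w) - X * v / Y" if "w \<noteq> 0" for u v w
          using that by (simp add: right_diff_distrib diff_divide_distrib)
        from this[OF that(2), of "(1 - Q * t) * (q * t)" "t * Q"] show ?thesis
          by (simp only: mult_ac times_divide_eq_right times_divide_eq_left)
      qed
      finally show ?thesis .
    qed
    show ?thesis
      using e3[OF qpoch_q_nonzero[of k], of "q ^ k" "qpoch q Q k"] nz
      unfolding w_def Q_def[symmetric] divide_inverse[of _ "q ^ n"] qpoch_Suc[of q Q] e1 e2
      by simp
  qed
  have "(\<Sum>k\<le>Suc n. w (Suc n) k * p (q ^ k * x))
     = w n 0 * p x + (\<Sum>k\<le>n. (w n (Suc k) - w n k / q ^ n) * p (q ^ Suc k * x))"
    by (subst sum.atMost_Suc_shift) (simp add: w0 w_Suc)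
  also have "\<dots> = (w n 0 * p x + (\<Sum>k\<le>n. w n (Suc k) * p (q ^ Suc k * x)))
       - (\<Sum>k\<le>n. w n k * p (q ^ k * (q * x))) / q ^ n"
    by (simp add: sum_subtractf sum_divide_distrib algebra_simps)
  also have "w n 0 * p x + (\<Sum>k\<le>n. w n (Suc k) * p (q ^ Suc k * x)) = (\<Sum>k\<le>Suc n. w n k * p (q ^ k * x))"
    by (subst sum.atMost_Suc_shift) simp
  also have "\<dots> = (\<Sum>k\<le>n. w n k * p (q ^ k * x))" by (simp add: w_out)
  finally show ?case
    by (simp add: Suc.IH w_def)
qed

end

section \<open>Polynomials in the shifted basis\<close>

lemma triangle_Suc: "Suc n * (Suc n - 1) div 2 = n * (n - 1) div 2 + n"
  by (induction n) (auto simp: algebra_simps)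

text \<open>On the unit circle this is \<open>z^j (c/z; q)\<^sub>j\<close>, so multiplying the weight by it
  amounts to \<open>c \<mapsto> c q^j\<close> in the kernel and \<open>N \<mapsto> z^j N\<close> in the numerator.\<close>
definition shifted_basis :: "complex \<Rightarrow> complex \<Rightarrow> nat \<Rightarrow> complex \<Rightarrow> complex" where
  "shifted_basis q c j z = (\<Prod>i<j. z - c * q ^ i)"

lemma shifted_basis_Suc: "shifted_basis q c (Suc j) z = shifted_basis q c j z * (z - c * q ^ j)"
  by (simp add: shifted_basis_def)

lemma shifted_basis_conv_qpoch:
  assumes "z \<noteq> 0"
  shows "shifted_basis q c j z = z ^ j * qpoch q (c / z) j"
proof (induction j)
  case (Suc j)
  have "z - c * q ^ j = z * (1 - c / z * q ^ j)" using assms by (simp add: field_simps)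
  then show ?case unfolding shifted_basis_Suc Suc.IH qpoch_Suc by (simp add: mult_ac)
qed (simp add: shifted_basis_def)

text \<open>\<open>p\<close> is a polynomial of degree at most \<open>m\<close> and \<open>l\<close> is its coefficient of \<open>z^m\<close>: the basis is monic, so
  that coefficient is also the last one of the expansion.\<close>
definition expands :: "complex \<Rightarrow> complex \<Rightarrow> nat \<Rightarrow> (complex \<Rightarrow> complex) \<Rightarrow> complex \<Rightarrow> bool" where
  "expands q c m p l \<longleftrightarrow> (\<exists>e. (\<forall>z. p z = (\<Sum>j\<le>m. e j * shifted_basis q c j z)) \<and> e m = l)"

lemma expands_const: "expands q c 0 (\<lambda>z. l) l"
  unfolding expands_def by (intro exI[of _ "\<lambda>j. l"]) (simp add: shifted_basis_def)

lemma expands_0: "expands q c m (\<lambda>z. 0) 0"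
  unfolding expands_def by (intro exI[of _ "\<lambda>j. 0"]) simp

lemma expands_add:
  assumes "expands q c m p l" "expands q c m p' l'"
  shows "expands q c m (\<lambda>z. p z + p' z) (l + l')"
proof -
  obtain e e' where "\<forall>z. p z = (\<Sum>j\<le>m. e j * shifted_basis q c j z)" "e m = l"
    "\<forall>z. p' z = (\<Sum>j\<le>m. e' j * shifted_basis q c j z)" "e' m = l'"
    using assms unfolding expands_def by blast
  then show ?thesis
    unfolding expands_def
    by (intro exI[of _ "\<lambda>j. e j + e' j"]) (simp add: sum.distrib ring_distribs)
qed

lemma expands_cmult:
  assumes "expands q c m p l"
  shows "expands q c m (\<lambda>z. t * p z) (t * l)"
proof -
  obtain e where "\<forall>z. p z = (\<Sum>j\<le>m. e j * shifted_basis q c j z)" "e m = l"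
    using assms unfolding expands_def by blast
  then show ?thesis
    unfolding expands_def
    by (intro exI[of _ "\<lambda>j. t * e j"]) (simp add: sum_distrib_left mult_ac)
qed

lemma expands_sum:
  assumes "finite I" "\<And>i. i \<in> I \<Longrightarrow> expands q c m (p i) (l i)"
  shows "expands q c m (\<lambda>z. \<Sum>i\<in>I. p i z) (\<Sum>i\<in>I. l i)"
  using assms by (induction I rule: finite_induct) (auto intro: expands_0 expands_add)

lemma expands_raise:
  assumes "expands q c k p l" "k < m"
  shows "expands q c m p 0"
proof -
  obtain e where e: "\<forall>z. p z = (\<Sum>j\<le>k. e j * shifted_basis q c j z)"
    using assms unfolding expands_def by blast
  have "(\<Sum>j\<le>k. e j * shifted_basis q c j z) = (\<Sum>j\<le>m. (if j \<le> k then e j else 0) * shifted_basis q c j z)" for z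
    using assms(2) by (intro sum.mono_neutral_cong_left) auto
  with e assms(2) show ?thesis
    unfolding expands_def by (intro exI[of _ "\<lambda>j. if j \<le> k then e j else 0"]) auto
qed

lemma expands_times_z:
  assumes "expands q c k p l"
  shows "expands q c (Suc k) (\<lambda>z. z * p z) l"
proof -
  obtain e where e: "\<forall>z. p z = (\<Sum>j\<le>k. e j * shifted_basis q c j z)" "e k = l"
    using assms unfolding expands_def by blast
  have "z * p z = (\<Sum>j\<le>k. (c * q ^ j * e j) * shifted_basis q c j z) +
      (\<Sum>j\<le>Suc k. (case j of 0 \<Rightarrow> 0 | Suc i \<Rightarrow> e i) * shifted_basis q c j z)" for z
    unfolding sum.atMost_Suc_shift
    by (simp add: e(1) sum_distrib_left shifted_basis_Suc algebra_simps flip: sum.distrib)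
  moreover have "expands q c (Suc k) (\<lambda>z. \<Sum>j\<le>k. (c * q ^ j * e j) * shifted_basis q c j z) 0"
  proof (rule expands_raise)
    show "expands q c k (\<lambda>z. \<Sum>j\<le>k. (c * q ^ j * e j) * shifted_basis q c j z) (c * q ^ k * e k)"
      unfolding expands_def by (intro exI[of _ "\<lambda>j. c * q ^ j * e j"]) simp
  qed simp
  moreover have "expands q c (Suc k)
      (\<lambda>z. \<Sum>j\<le>Suc k. (case j of 0 \<Rightarrow> 0 | Suc i \<Rightarrow> e i) * shifted_basis q c j z) l"
    unfolding expands_def
    by (intro exI[of _ "case_nat 0 e"]) (simp add: e(2) del: sum.atMost_Suc)
  ultimately show ?thesis
    using expands_add by fastforce
qed

lemma expands_qpoch: "expands q c k (\<lambda>z. qpoch q (a * z) k) ((- a) ^ k * q ^ (k * (k - 1) div 2))"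
proof (induction k)
  case 0
  then show ?case using expands_const[of q c 1] by simp
next
  case (Suc k)
  let ?l = "(- a) ^ k * q ^ (k * (k - 1) div 2)"
  have "expands q c (Suc k) (\<lambda>z. qpoch q (a * z) k + (- a * q ^ k) * (z * qpoch q (a * z) k)) (0 + (- a * q ^ k) * ?l)"
    by (intro expands_add expands_cmult expands_times_z Suc.IH expands_raise[OF Suc.IH]) simp
  moreover have "0 + (- a * q ^ k) * ?l = (- a) ^ Suc k * q ^ (Suc k * (Suc k - 1) div 2)"
    unfolding triangle_Suc by (simp add: power_add)
  moreover have "(\<lambda>z. qpoch q (a * z) k + (- a * q ^ k) * (z * qpoch q (a * z) k)) = (\<lambda>z. qpoch q (a * z) (Suc k))"
    by (simp add: fun_eq_iff qpoch_Suc algebra_simps)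
  ultimately show ?case by (simp only:)
qed

text \<open>Each factor \<open>1 - q\<^bsup>i-n\<^esup>\<close> is \<open>- q\<^bsup>i-n\<^esup> (1 - q\<^bsup>n-i\<^esup>)\<close>; the powers of \<open>q\<close> that are taken out sum up to a
  triangular number.\<close>
lemma qpoch_inverse_power_reversed:
  assumes "q \<noteq> 0"
  shows "(- 1) ^ n * q ^ (n * (n - 1) div 2) * q ^ n * qpoch q (inverse (q ^ n)) n = qpoch q q n"
proof (induction n)
  case (Suc n)
  have eq: "inverse (q ^ Suc n) * q = inverse (q ^ n)" using assms by simp
  have inv: "q ^ Suc n * (1 - inverse (q ^ Suc n)) = - (1 - q ^ Suc n)"
    using assms by (simp add: right_diff_distrib del: power_Suc)
  have "(- 1) ^ Suc n * q ^ (Suc n * (Suc n - 1) div 2) * q ^ Suc n * qpoch q (inverse (q ^ Suc n)) (Suc n)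
      = - (q ^ Suc n * (1 - inverse (q ^ Suc n))) *
        ((- 1) ^ n * q ^ (n * (n - 1) div 2) * q ^ n * qpoch q (inverse (q ^ n)) n)"
    unfolding triangle_Suc qpoch_Suc_left eq by (simp add: power_add mult_ac)
  also have "\<dots> = qpoch q q n * (1 - q * q ^ n)"
    unfolding inv Suc.IH by simp
  finally show ?case by (simp add: qpoch_Suc)
qed simp

section \<open>Orthogonality of the q-Hahn polynomials\<close>

definition qtheta :: "complex \<Rightarrow> complex \<Rightarrow> complex" where
  "qtheta q x = qpoch_inf q x * qpoch_inf q (q / x)"

definition AR_numerator :: "complex \<Rightarrow> complex \<Rightarrow> complex \<Rightarrow> complex \<Rightarrow> complex \<Rightarrow> complex" where
  "AR_numerator q c d \<rho> z = qtheta q (\<rho> * z / d) * qtheta q (\<rho> * c / z)"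

text \<open>The upper parameter \<open>abcd q\<^bsup>n-1\<^esup>\<close> of the series for \<open>H\<^sub>n\<close>, without an integer exponent.\<close>
definition upper_param :: "complex \<Rightarrow> complex \<Rightarrow> complex \<Rightarrow> complex \<Rightarrow> complex \<Rightarrow> nat \<Rightarrow> complex" where
  "upper_param q a b c d n = a * b * c * d * q ^ n / q"

definition Hahn_coeff :: "complex \<Rightarrow> complex \<Rightarrow> complex \<Rightarrow> complex \<Rightarrow> complex \<Rightarrow> nat \<Rightarrow> nat \<Rightarrow> complex" where
  "Hahn_coeff q a b c d n k = qpoch q (inverse (q ^ n)) k / qpoch q q k * q ^ k *
     (qpoch q (upper_param q a b c d n) k / (qpoch q (a * c) k * qpoch q (a * d) k))"

context
  fixes q :: complex
  assumes q0: "q \<noteq> 0" and q1: "norm q < 1"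
begin

lemma qtheta_shift:
  assumes "x \<noteq> 0"
  shows "x * qtheta q (q * x) = - qtheta q x"
proof -
  have 1: "qpoch_inf q x = (1 - x) * qpoch_inf q (q * x)"
    using qpoch_inf_rec[OF q1, of x] by (simp add: mult_ac)
  have 2: "qpoch_inf q (1 / x) = (1 - 1 / x) * qpoch_inf q (q / x)"
    using qpoch_inf_rec[OF q1, of "1 / x"] by simp
  have 3: "q / (q * x) = 1 / x" using q0 by simp
  have "x * (1 - 1 / x) = - (1 - x)" using assms by (simp add: field_simps)
  then have "x * (A * ((1 - 1 / x) * B)) = - ((1 - x) * A * B)" for A B
    by (metis mult.assoc mult.left_commute mult_minus_left)
  then show ?thesis unfolding qtheta_def 3 1 2 by simp
qed

text \<open>Under \<open>z \<mapsto> qz\<close> the first theta function is multiplied by \<open>- d / (\<rho> z)\<close> and the second one by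
  \<open>- \<rho> c / (qz)\<close>; in the product of these multipliers \<open>\<rho>\<close> cancels.\<close>
lemma theta_numerator_AR_numerator:
  assumes "c \<noteq> 0" "d \<noteq> 0" "\<rho> \<noteq> 0"
  shows "theta_numerator q c d (AR_numerator q c d \<rho>)"
  unfolding theta_numerator_def
proof (intro conjI allI impI)
  show "AR_numerator q c d \<rho> holomorphic_on - {0}"
    unfolding AR_numerator_def[abs_def] qtheta_def
    by (intro holomorphic_on_mult holomorphic_on_divide holomorphic_on_qpoch_inf[OF q1]
        holomorphic_on_const holomorphic_on_ident) (use assms in auto)
  fix z :: complex assume z: "z \<noteq> 0"
  have 1: "\<rho> * z / d * qtheta q (\<rho> * (q * z) / d) = - qtheta q (\<rho> * z / d)"
    using qtheta_shift[of "\<rho> * z / d"] assms z by (simp add: mult_ac)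
  have 2: "\<rho> * c / (q * z) * qtheta q (\<rho> * c / z) = - qtheta q (\<rho> * c / (q * z))"
    using qtheta_shift[of "\<rho> * c / (q * z)"] assms z q0 by (simp add: mult_ac)
  have "\<rho> * z / d * AR_numerator q c d \<rho> (q * z) =
      (\<rho> * z / d * qtheta q (\<rho> * (q * z) / d)) * qtheta q (\<rho> * c / (q * z))"
    by (simp add: AR_numerator_def)
  also have "\<dots> = qtheta q (\<rho> * z / d) * (\<rho> * c / (q * z) * qtheta q (\<rho> * c / z))"
    unfolding 1 2 by simp
  also have "\<dots> = \<rho> * c / (q * z) * AR_numerator q c d \<rho> z" by (simp add: AR_numerator_def)
  finally show "q * z\<^sup>2 * AR_numerator q c d \<rho> (q * z) = c * d * AR_numerator q c d \<rho> z"
    using assms z q0 by (simp add: field_simps power2_eq_square)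
qed

lemma q_Hahn_weight_factorization:
  "q_Hahn_weight q a b c d \<rho> \<theta> = AR_numerator q c d \<rho> (cis \<theta>) * AR_kernel q a b c d (cis \<theta>)"
proof -
  have cis: "cis (- \<theta>) = 1 / cis \<theta>" by (metis cis_inverse inverse_eq_divide)
  show ?thesis
    unfolding q_Hahn_weight_def AR_numerator_def AR_kernel_def qtheta_def qpochs_inf_def cis
    by (simp add: mult_ac)
qed

lemma AR_kernel_shift:
  assumes "norm z = 1" "norm a < 1" "norm c < 1"
  shows "z ^ j * AR_kernel q (a * q ^ k) b (c * q ^ j) d z
       = qpoch q (a * z) k * shifted_basis q c j z * AR_kernel q a b c d z"
proof -
  have "z \<noteq> 0" using assms by auto
  have 1: "qpoch_inf q (a * z) = qpoch q (a * z) k * qpoch_inf q (a * q ^ k * z)"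
    using qpoch_inf_split[OF q1, of "a * z" k] by (simp add: mult_ac)
  have 2: "qpoch_inf q (c / z) = qpoch q (c / z) j * qpoch_inf q (c * q ^ j / z)"
    using qpoch_inf_split[OF q1, of "c / z" j] by simp
  have "norm (a * z) < 1" "norm (c / z) < 1" using assms by (simp_all add: norm_mult norm_divide)
  then have "qpoch q (a * z) k \<noteq> 0" "qpoch q (c / z) j \<noteq> 0" by (simp_all add: qpoch_nonzero[OF _ q1])
  then show ?thesis
    unfolding AR_kernel_def 1 2 shifted_basis_conv_qpoch[OF \<open>z \<noteq> 0\<close>] by simp
qed

context
  fixes a b c d :: complex and N :: "complex \<Rightarrow> complex"
  assumes small: "norm a < 1" "norm b < 1" "norm c < 1" "norm d < 1"
    and a0: "a \<noteq> 0" and d0: "d \<noteq> 0" and abcd: "a * b * c * d \<noteq> q"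
    and N: "theta_numerator q c d N"
begin

abbreviation functional :: "(complex \<Rightarrow> complex) \<Rightarrow> complex" where
  "functional p \<equiv> circle_mean (\<lambda>z. N z * AR_kernel q a b c d z * p z)"

abbreviation mass :: complex where "mass \<equiv> functional (\<lambda>z. 1)"

lemma norm_products:
  "norm (a * c) < 1" "norm (a * d) < 1" "norm (b * c) < 1" "norm (b * d) < 1" "norm (a * b * c * d) < 1"
  using small by (auto intro!: norm_mult_less_one)

lemma continuous_on_weight: "continuous_on (sphere 0 1) (\<lambda>z. N z * AR_kernel q a b c d z)"
  using theta_numerator_continuous[OF q0 q1 N] continuous_on_AR_kernel[OF q0 q1 small]
  by (intro continuous_intros)

lemma functional_sum:
  assumes "finite I" "\<And>i. i \<in> I \<Longrightarrow> continuous_on (sphere 0 1) (p i)"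
  shows "functional (\<lambda>z. \<Sum>i\<in>I. t i * p i z) = (\<Sum>i\<in>I. t i * functional (p i))"
proof -
  have "functional (\<lambda>z. \<Sum>i\<in>I. t i * p i z) = circle_mean (\<lambda>z. \<Sum>i\<in>I. t i * (N z * AR_kernel q a b c d z * p i z))"
    by (simp add: sum_distrib_left mult_ac)
  also have "\<dots> = (\<Sum>i\<in>I. circle_mean (\<lambda>z. t i * (N z * AR_kernel q a b c d z * p i z)))"
    using assms
    by (intro circle_mean_sum continuous_on_mult_left continuous_on_mult[OF continuous_on_weight]) auto
  finally show ?thesis by (simp only: circle_mean_cmult)
qed

text \<open>Numerator and kernel are of the same type after the substitution \<open>a \<mapsto> a q^k\<close>, \<open>c \<mapsto> c q^j\<close>,
  \<open>N \<mapsto> z^j N\<close>, so this is a quotient of two Askey--Roy integrals; the factor \<open>d^j\<close> is \<open>z^j\<close> at \<open>z = d\<close>.\<close>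
lemma functional_moment:
  "functional (\<lambda>z. qpoch q (a * z) k * shifted_basis q c j z) =
     d ^ j * qpoch q (a * c) (k + j) * qpoch q (a * d) k * qpoch q (b * c) j / qpoch q (a * b * c * d) (k + j) * mass"
proof -
  have small': "norm (a * q ^ k) < 1" "norm (c * q ^ j) < 1"
    using norm_mult_power_less_one small q1 by blast+
  have "functional (\<lambda>z. qpoch q (a * z) k * shifted_basis q c j z)
      = circle_mean (\<lambda>z. z ^ j * N z * AR_kernel q (a * q ^ k) b (c * q ^ j) d z)"
  proof (rule circle_mean_cong)
    fix z :: complex assume "norm z = 1"
    from AR_kernel_shift[OF this small(1,3), of j k b d]
    show "N z * AR_kernel q a b c d z * (qpoch q (a * z) k * shifted_basis q c j z) =
       z ^ j * N z * AR_kernel q (a * q ^ k) b (c * q ^ j) d z"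
      by (simp add: mult_ac)
  qed
  also have "\<dots> = qpoch_inf q (a * b * c * d * q ^ (k + j)) * (d ^ j * N d) /
     (qpoch_inf q q * qpoch_inf q (a * c * q ^ (k + j)) * qpoch_inf q (a * d * q ^ k) *
      qpoch_inf q (b * c * q ^ j) * qpoch_inf q (b * d))"
    using Askey_Roy_integral[OF q0 q1 small'(1) small(2) small'(2) small(4) d0 theta_numerator_shift[OF N]]
    by (simp add: power_add mult_ac)
  finally have 1: "functional (\<lambda>z. qpoch q (a * z) k * shifted_basis q c j z) = \<dots>" .
  have 2: "mass = qpoch_inf q (a * b * c * d) * N d / (qpoch_inf q q * qpoch_inf q (a * c) *
      qpoch_inf q (a * d) * qpoch_inf q (b * c) * qpoch_inf q (b * d))"
    using Askey_Roy_integral[OF q0 q1 small d0 N] by simp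
  have nz: "qpoch q x i \<noteq> 0" "qpoch_inf q (x * q ^ i) \<noteq> 0" if "norm x < 1" for x i
    using qpoch_nonzero qpoch_inf_nonzero norm_mult_power_less_one that q1 by blast+
  show ?thesis
    unfolding 1 2 qpoch_inf_split[OF q1, of "a * b * c * d" "k + j"] qpoch_inf_split[OF q1, of "a * c" "k + j"]
      qpoch_inf_split[OF q1, of "a * d" k] qpoch_inf_split[OF q1, of "b * c" j]
    using nz[OF norm_products(1)] nz[OF norm_products(2)] nz[OF norm_products(3)] nz[OF norm_products(5)]
    by simp (simp only: mult_ac)
qed

lemma upper_param_Suc: "upper_param q a b c d (Suc n) = a * b * c * d * q ^ n"
  using q0 by (simp add: upper_param_def)

text \<open>Apart from the first one these are \<open>abcd q^i\<close> with \<open>i \<ge> 0\<close>, of modulus below \<open>1\<close>; the first is \<open>abcd / q\<close>.\<close>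
lemma upper_param_times_power_neq_1: "upper_param q a b c d n * q ^ k \<noteq> 1"
proof (cases "n + k")
  case 0
  then show ?thesis using abcd q0 by (simp add: upper_param_def divide_simps)
next
  case (Suc i)
  have "upper_param q a b c d n * q ^ k = a * b * c * d * q ^ (n + k) / q"
    by (simp add: upper_param_def power_add)
  also have "\<dots> = a * b * c * d * q ^ i" using q0 by (simp add: Suc)
  finally show ?thesis
    using norm_mult_power_less_one[OF norm_products(5) q1, of i] by auto
qed

lemma qpoch_upper_param_nonzero: "qpoch q (upper_param q a b c d n) k \<noteq> 0"
  using upper_param_times_power_neq_1 by (auto simp: qpoch_def)

lemma q_Hahn_conv_sum:
  "q_Hahn q a b c d n z = qpoch q (a * c) n * qpoch q (a * d) n / a ^ n *
     (\<Sum>k\<le>n. Hahn_coeff q a b c d n k * qpoch q (a * z) k)"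
proof -
  have p: "q powi (- int n) = inverse (q ^ n)" "a * b * c * d * q powi (int n - 1) = upper_param q a b c d n"
    using q0 by (simp_all add: power_int_minus power_int_diff upper_param_def)
  have "(\<Sum>k. qpochs q [inverse (q ^ n), upper_param q a b c d n, a * z] k / qpochs q [q, a * c, a * d] k * q ^ k)
      = (\<Sum>k\<le>n. qpochs q [inverse (q ^ n), upper_param q a b c d n, a * z] k / qpochs q [q, a * c, a * d] k * q ^ k)"
    by (intro suminf_finite) (simp_all add: qpochs_def qpoch_inverse_power_eq_0[OF q0 q1])
  also have "\<dots> = (\<Sum>k\<le>n. Hahn_coeff q a b c d n k * qpoch q (a * z) k)"
    by (intro sum.cong) (simp_all add: qpochs_def Hahn_coeff_def mult_ac)
  finally show ?thesis
    unfolding q_Hahn_def phi32_def p by (simp add: qpochs_def)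
qed

text \<open>Only the term \<open>k = n\<close> of the series contributes to the leading coefficient, and there all powers of \<open>q\<close>
  cancel because \<open>(q\<^bsup>-n\<^esup>; q)\<^sub>n\<close> is, up to a sign and a power of \<open>q\<close>, the product \<open>(q; q)\<^sub>n\<close> read backwards.\<close>
lemma q_Hahn_expands: "expands q c n (q_Hahn q a b c d n) (qpoch q (upper_param q a b c d n) n)"
proof -
  define pre where "pre = qpoch q (a * c) n * qpoch q (a * d) n / a ^ n"
  define l where "l k = (if k = n then (- a) ^ n * q ^ (n * (n - 1) div 2) else 0)" for k
  have "expands q c n (\<lambda>z. qpoch q (a * z) k) (l k)" if "k \<le> n" for k
    using that expands_qpoch[of q c k a] expands_raise[OF expands_qpoch[of q c k a], of n]
    by (auto simp: l_def)
  then have "expands q c n (\<lambda>z. pre * (\<Sum>k\<le>n. Hahn_coeff q a b c d n k * qpoch q (a * z) k))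
      (pre * (\<Sum>k\<le>n. Hahn_coeff q a b c d n k * l k))"
    by (intro expands_cmult expands_sum) auto
  moreover have "pre * (\<Sum>k\<le>n. Hahn_coeff q a b c d n k * l k) = qpoch q (upper_param q a b c d n) n"
  proof -
    have "(\<Sum>k\<le>n. Hahn_coeff q a b c d n k * l k) = (\<Sum>k\<in>{n}. Hahn_coeff q a b c d n k * l k)"
      by (intro sum.mono_neutral_right) (auto simp: l_def)
    then have "(\<Sum>k\<le>n. Hahn_coeff q a b c d n k * l k) = Hahn_coeff q a b c d n n * ((- a) ^ n * q ^ (n * (n - 1) div 2))"
      by (simp add: l_def)
    also have "\<dots> = a ^ n * ((- 1) ^ n * q ^ (n * (n - 1) div 2) * q ^ n * qpoch q (inverse (q ^ n)) n)
        / qpoch q q n * (qpoch q (upper_param q a b c d n) n / (qpoch q (a * c) n * qpoch q (a * d) n))"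
      by (simp add: Hahn_coeff_def power_minus[of a] mult_ac)
    also have "\<dots> = a ^ n * (qpoch q (upper_param q a b c d n) n / (qpoch q (a * c) n * qpoch q (a * d) n))"
      unfolding qpoch_inverse_power_reversed[OF q0] using qpoch_q_nonzero[OF q0 q1] by simp
    finally show ?thesis
      using a0 qpoch_nonzero[OF norm_products(1) q1] qpoch_nonzero[OF norm_products(2) q1]
      by (simp add: pre_def)
  qed
  ultimately show ?thesis
    unfolding q_Hahn_conv_sum[abs_def] pre_def by (simp only:)
qed

lemma continuous_on_q_Hahn: "continuous_on S (q_Hahn q a b c d n)"
  unfolding q_Hahn_conv_sum[abs_def] qpoch_def by (intro continuous_intros)

lemma functional_Hahn_basis:
  "functional (\<lambda>z. q_Hahn q a b c d n z * shifted_basis q c j z) =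
     qpoch q (a * c) n * qpoch q (a * d) n / a ^ n * d ^ j * qpoch q (b * c) j * mass *
     (\<Sum>k\<le>n. qpoch q (inverse (q ^ n)) k / qpoch q q k * q ^ k *
       (qpoch q (upper_param q a b c d n) k * qpoch q (a * c * q ^ k) j / qpoch q (a * b * c * d) (k + j)))"
proof -
  define pre where "pre = qpoch q (a * c) n * qpoch q (a * d) n / a ^ n"
  have "functional (\<lambda>z. q_Hahn q a b c d n z * shifted_basis q c j z) =
      functional (\<lambda>z. \<Sum>k\<le>n. (pre * Hahn_coeff q a b c d n k) * (qpoch q (a * z) k * shifted_basis q c j z))"
    by (simp add: q_Hahn_conv_sum pre_def sum_distrib_left sum_distrib_right mult_ac)
  also have "\<dots> = (\<Sum>k\<le>n. (pre * Hahn_coeff q a b c d n k) *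
      functional (\<lambda>z. qpoch q (a * z) k * shifted_basis q c j z))"
    by (intro functional_sum) (auto simp: qpoch_def shifted_basis_def intro!: continuous_intros)
  also have "\<dots> = (\<Sum>k\<le>n. (pre * d ^ j * qpoch q (b * c) j * mass) *
      (qpoch q (inverse (q ^ n)) k / qpoch q q k * q ^ k *
       (qpoch q (upper_param q a b c d n) k * qpoch q (a * c * q ^ k) j / qpoch q (a * b * c * d) (k + j))))"
  proof (intro sum.cong refl)
    fix k
    show "(pre * Hahn_coeff q a b c d n k) * functional (\<lambda>z. qpoch q (a * z) k * shifted_basis q c j z) =
      (pre * d ^ j * qpoch q (b * c) j * mass) * (qpoch q (inverse (q ^ n)) k / qpoch q q k * q ^ k *
       (qpoch q (upper_param q a b c d n) k * qpoch q (a * c * q ^ k) j / qpoch q (a * b * c * d) (k + j)))"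
      unfolding functional_moment Hahn_coeff_def qpoch_add[of q "a * c"]
      using qpoch_nonzero[OF norm_products(1) q1, of k] qpoch_nonzero[OF norm_products(2) q1, of k]
      by simp
  qed
  finally show ?thesis by (simp add: sum_distrib_left pre_def)
qed

text \<open>With \<open>x = q^k\<close>, the factor \<open>(abcdq\<^bsup>n-1\<^esup>; q)\<^sub>k / (abcd; q)\<^bsub>k+j\<^esub>\<close> is a polynomial in \<open>x\<close> of degree
  \<open>n - 1 - j\<close>, and \<open>(acx; q)\<^sub>j\<close> has degree \<open>j\<close>; together they stay below \<open>n\<close>.\<close>
lemma functional_Hahn_basis_eq_0:
  assumes "j < n"
  shows "functional (\<lambda>z. q_Hahn q a b c d n z * shifted_basis q c j z) = 0"
proof -
  obtain m where m: "n = Suc m" using assms by (cases n) auto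
  define C where "C = a * b * c * d"
  have nz: "qpoch q C k \<noteq> 0" for k
    unfolding C_def by (rule qpoch_nonzero[OF norm_products(5) q1])
  have "qpoch q (upper_param q a b c d n) k * qpoch q (a * c * q ^ k) j / qpoch q C (k + j)
      = 1 / qpoch q C m * ((q ^ k * 1) ^ 0 * qpoch q (a * c * (q ^ k * 1)) j * qpoch q (C * q ^ j * (q ^ k * 1)) (m - j))"
    for k
  proof -
    have "qpoch q C m * qpoch q (upper_param q a b c d n) k = qpoch q C (m + k)"
      unfolding m upper_param_Suc C_def[symmetric] by (simp add: qpoch_add)
    also have "m + k = (k + j) + (m - j)" using assms m by simp
    also have "qpoch q C \<dots> = qpoch q C (k + j) * qpoch q (C * q ^ j * q ^ k) (m - j)"
      by (subst qpoch_add) (simp add: power_add mult_ac)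
    finally show ?thesis
      using nz[of m] nz[of "k + j"] by (simp add: field_simps)
  qed
  then have "(\<Sum>k\<le>n. qpoch q (inverse (q ^ n)) k / qpoch q q k * q ^ k *
       (qpoch q (upper_param q a b c d n) k * qpoch q (a * c * q ^ k) j / qpoch q C (k + j)))
     = qdiff q n (\<lambda>x. 1 / qpoch q C m * (x ^ 0 * qpoch q (a * c * x) j * qpoch q (C * q ^ j * x) (m - j))) 1"
    unfolding qdiff_conv_sum[OF q0 q1] by (simp only:)
  also have "\<dots> = 0"
    unfolding qdiff_cmult using assms m by (subst qdiff_qpoch_eq_0[OF q0 q1]) auto
  finally show ?thesis unfolding functional_Hahn_basis C_def by simp
qed

text \<open>Read the product backwards: \<open>abcdq\<^bsup>n-1\<^esup> - acq\<^bsup>n-1-i\<^esup>\<close> is \<open>- acq\<^bsup>n-1-i\<^esup> (1 - bdq^i)\<close>.\<close>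
lemma upper_param_product:
  "(\<Prod>i<n. upper_param q a b c d n - a * c * q ^ i) = (- (a * c)) ^ n * q ^ (n * (n - 1) div 2) * qpoch q (b * d) n"
proof -
  have "(\<Prod>i<n. upper_param q a b c d n - a * c * q ^ i) = (\<Prod>i<n. upper_param q a b c d n - a * c * q ^ (n - Suc i))"
    by (rule prod.nat_diff_reindex[symmetric])
  also have "\<dots> = (\<Prod>i<n. (- (a * c)) * q ^ (n - Suc i) * (1 - b * d * q ^ i))"
  proof (intro prod.cong refl)
    fix i assume "i \<in> {..<n}"
    then have n: "n = Suc ((n - Suc i) + i)" by simp
    have "upper_param q a b c d n = a * c * q ^ (n - Suc i) * (b * d * q ^ i)"
      by (subst n, subst upper_param_Suc) (simp add: power_add mult_ac)
    then show "upper_param q a b c d n - a * c * q ^ (n - Suc i) = - (a * c) * q ^ (n - Suc i) * (1 - b * d * q ^ i)"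
      by (simp add: algebra_simps)
  qed
  also have "\<dots> = (- (a * c)) ^ n * (\<Prod>i<n. q ^ (n - Suc i)) * qpoch q (b * d) n"
    by (simp only: prod.distrib qpoch_def prod_constant card_lessThan)
  also have "(\<Prod>i<n. q ^ (n - Suc i)) = (\<Prod>i<n. q ^ i)"
    by (rule prod.nat_diff_reindex)
  also have "\<dots> = q ^ (n * (n - 1) div 2)"
    by (induction n) (simp_all only: triangle_Suc power_add prod.lessThan_Suc, simp_all)
  finally show ?thesis .
qed

text \<open>For \<open>j = n\<close> the same quotient is a constant over \<open>1 - abcdq\<^bsup>n-1\<^esup> x\<close>, so the sum is the explicit value of the
  \<open>q\<close>-difference operator on \<open>(acx; q)\<^sub>n\<close> over a linear factor.\<close>
lemma functional_Hahn_basis_same: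
  "qpoch q (upper_param q a b c d n) n * functional (\<lambda>z. q_Hahn q a b c d n z * shifted_basis q c n z) =
     qpoch q (a * c) n * qpoch q (a * d) n * qpoch q (b * c) n * qpoch q (b * d) n * qpoch q q n *
     q ^ (n * (n - 1) div 2) * (- (c * d)) ^ n * (1 - upper_param q a b c d n) /
     (qpoch q (a * b * c * d) n * (1 - upper_param q a b c d n * q ^ n)) * mass"
proof -
  define C where "C = a * b * c * d"
  define B where "B = upper_param q a b c d n"
  have nz: "qpoch q C k \<noteq> 0" for k
    unfolding C_def by (rule qpoch_nonzero[OF norm_products(5) q1])
  have nzB: "1 - B * q ^ k \<noteq> 0" for k
    using upper_param_times_power_neq_1[of n k] by (simp add: B_def)
  have Bq: "B * q = C * q ^ n" using q0 by (simp add: B_def C_def upper_param_def)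
  have "qpoch q B k * qpoch q (a * c * q ^ k) n / qpoch q C (k + n)
      = (1 - B) / qpoch q C n * (qpoch q (a * c * (q ^ k * 1)) n / (1 - B * (q ^ k * 1)))" for k
  proof -
    have "qpoch q B k * (1 - B * q ^ k) = (1 - B) * qpoch q (C * q ^ n) k"
      using qpoch_Suc[of q B k] qpoch_Suc_left[of q B k] by (simp add: Bq)
    moreover have "qpoch q C (k + n) = qpoch q C n * qpoch q (C * q ^ n) k"
      by (subst add.commute) (rule qpoch_add)
    ultimately show ?thesis
      using nz[of n] nz[of "k + n"] nzB[of k] by (simp add: divide_simps)
  qed
  then have "(\<Sum>k\<le>n. qpoch q (inverse (q ^ n)) k / qpoch q q k * q ^ k *
       (qpoch q B k * qpoch q (a * c * q ^ k) n / qpoch q C (k + n)))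
     = qdiff q n (\<lambda>x. (1 - B) / qpoch q C n * (qpoch q (a * c * x) n / (1 - B * x))) 1"
    unfolding qdiff_conv_sum[OF q0 q1] by (simp only:)
  also have "\<dots> = (1 - B) / qpoch q C n *
      (qpoch q q n * ((- (a * c)) ^ n * q ^ (n * (n - 1) div 2) * qpoch q (b * d) n) / qpoch q B (Suc n))"
    unfolding qdiff_cmult upper_param_product[of n, folded B_def, symmetric]
    using nzB by (subst qdiff_qpoch_over_linear[OF q0 q1]) auto
  finally have S: "(\<Sum>k\<le>n. qpoch q (inverse (q ^ n)) k / qpoch q q k * q ^ k *
       (qpoch q B k * qpoch q (a * c * q ^ k) n / qpoch q C (k + n))) = \<dots>" .
  have p: "d ^ n / a ^ n * (- (a * c)) ^ n = (- (c * d)) ^ n"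
    using a0 by (simp add: power_mult_distrib power_minus[of "_ * _"] field_simps)
  have "qpoch q B n * functional (\<lambda>z. q_Hahn q a b c d n z * shifted_basis q c n z) =
     qpoch q (a * c) n * qpoch q (a * d) n * qpoch q (b * c) n * qpoch q (b * d) n * qpoch q q n *
     q ^ (n * (n - 1) div 2) * (d ^ n / a ^ n * (- (a * c)) ^ n) * (1 - B) /
     (qpoch q C n * (1 - B * q ^ n)) * mass"
    unfolding functional_Hahn_basis C_def[symmetric] B_def[symmetric] S qpoch_Suc[of q B n]
    using qpoch_upper_param_nonzero[of n n] unfolding B_def[symmetric]
    by simp
  then show ?thesis unfolding p B_def C_def .
qed

text \<open>This brings the constant that comes out of the computation into the customary form.  The products differ by a
  shift of the argument by \<open>q\<close>, and \<open>abcd \<noteq> q\<close> keeps the one on the right away from zero.\<close>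
lemma norm_constant:
  "(1 - upper_param q a b c d n) / qpoch q (a * b * c * d) n = (1 - upper_param q a b c d 0) / qpoch q (upper_param q a b c d 0) n"
proof -
  have "qpoch q (upper_param q a b c d 0) n * (1 - upper_param q a b c d n) = (1 - upper_param q a b c d 0) * qpoch q (a * b * c * d) n"
    using qpoch_Suc[of q "upper_param q a b c d 0" n] qpoch_Suc_left[of q "upper_param q a b c d 0" n] q0
    by (simp add: upper_param_def)
  then show ?thesis
    using qpoch_nonzero[OF norm_products(5) q1, of n] qpoch_upper_param_nonzero[of 0 n]
    by (simp add: divide_simps mult_ac)
qed

text \<open>Expand the polynomial of lower degree in the basis: only its coefficient of index \<open>n\<close> meets a nonzero moment.\<close>
lemma functional_Hahn_Hahn:
  assumes "m \<le> n"
  shows "functional (\<lambda>z. q_Hahn q a b c d n z * q_Hahn q a b c d m z) =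
    (if m = n then
       (1 - upper_param q a b c d 0) * (qpoch q q n * qpoch q (a * c) n * qpoch q (a * d) n * qpoch q (b * c) n * qpoch q (b * d) n) *
       q ^ (n * (n - 1) div 2) * (- (c * d)) ^ n / ((1 - upper_param q a b c d n * q ^ n) * qpoch q (upper_param q a b c d 0) n) * mass
     else 0)"
proof -
  obtain e where e: "\<And>z. q_Hahn q a b c d m z = (\<Sum>j\<le>m. e j * shifted_basis q c j z)"
    "e m = qpoch q (upper_param q a b c d m) m"
    using q_Hahn_expands[of m] unfolding expands_def by blast
  have "functional (\<lambda>z. q_Hahn q a b c d n z * q_Hahn q a b c d m z) =
      functional (\<lambda>z. \<Sum>j\<le>m. e j * (q_Hahn q a b c d n z * shifted_basis q c j z))"
    by (simp add: e(1) sum_distrib_left mult_ac)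
  also have "\<dots> = (\<Sum>j\<le>m. e j * functional (\<lambda>z. q_Hahn q a b c d n z * shifted_basis q c j z))"
    by (intro functional_sum continuous_on_mult continuous_on_q_Hahn)
       (auto simp: shifted_basis_def intro!: continuous_intros)
  also have "\<dots> = (\<Sum>j\<in>(if m = n then {n} else {}). e j * functional (\<lambda>z. q_Hahn q a b c d n z * shifted_basis q c j z))"
    using assms by (intro sum.mono_neutral_right) (auto simp: functional_Hahn_basis_eq_0)
  also have "\<dots> = (if m = n then qpoch q (upper_param q a b c d n) n *
       functional (\<lambda>z. q_Hahn q a b c d n z * shifted_basis q c n z) else 0)"
    using e(2) by auto
  also have "\<dots> = (if m = n then
       (1 - upper_param q a b c d n) / qpoch q (a * b * c * d) n *
       (qpoch q q n * qpoch q (a * c) n * qpoch q (a * d) n * qpoch q (b * c) n * qpoch q (b * d) n) *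
       q ^ (n * (n - 1) div 2) * (- (c * d)) ^ n / (1 - upper_param q a b c d n * q ^ n) * mass
     else 0)"
    unfolding functional_Hahn_basis_same by simp
  finally show ?thesis unfolding norm_constant by simp
qed

end

end


(* The assumptions a \<noteq> 0 and a b c d \<noteq> q say that no zero factor occurs in a denominator:
   all other denominators are nonzero because |q| < 1, max {|a|, |b|, |c|, |d|} < 1
   and c d \<rho> \<noteq> 0. *)
theorem theorem3p5:
  fixes q a b c d \<rho> :: complex and m n :: nat
  assumes "q \<noteq> 0" and "cmod q < 1"
    and "Max {cmod a, cmod b, cmod c, cmod d} < 1"
    and "c * d * \<rho> \<noteq> 0"
    and "a \<noteq> 0" and "a * b * c * d \<noteq> q"
  shows "(\<lambda>\<theta>. q_Hahn_weight q a b c d \<rho> \<theta> * q_Hahn q a b c d n (cis \<theta>) * q_Hahn q a b c d m (cis \<theta>))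
           integrable_on {-pi..pi} \<and>
         1 / (2 * of_real pi) *
           integral {-pi..pi}
             (\<lambda>\<theta>. q_Hahn_weight q a b c d \<rho> \<theta> * q_Hahn q a b c d n (cis \<theta>) * q_Hahn q a b c d m (cis \<theta>))
         = q_Hahn_L q a b c d \<rho> n * (if m = n then 1 else 0)"
proof -
  have small: "norm a < 1" "norm b < 1" "norm c < 1" "norm d < 1" using assms(3) by auto
  have nz: "c \<noteq> 0" "d \<noteq> 0" "\<rho> \<noteq> 0" using assms(4) by auto
  define N where "N = AR_numerator q c d \<rho>"
  have N: "theta_numerator q c d N"
    unfolding N_def by (rule theta_numerator_AR_numerator[OF assms(1,2) nz])
  note ctx = assms(1,2) small assms(5) nz(2) assms(6) N
  define F where "F z = N z * AR_kernel q a b c d z * (q_Hahn q a b c d n z * q_Hahn q a b c d m z)" for z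
  have integrand: "(\<lambda>\<theta>. q_Hahn_weight q a b c d \<rho> \<theta> * q_Hahn q a b c d n (cis \<theta>) * q_Hahn q a b c d m (cis \<theta>))
      = (\<lambda>\<theta>. F (cis \<theta>))"
    by (simp add: fun_eq_iff F_def N_def q_Hahn_weight_factorization[OF assms(1,2)] mult.assoc)
  have "continuous_on (sphere 0 1) F"
    unfolding F_def
    by (intro continuous_on_mult[OF continuous_on_weight[OF ctx]] continuous_on_mult
        continuous_on_q_Hahn[OF ctx])
  then have integrable: "(\<lambda>\<theta>. F (cis \<theta>)) integrable_on {-pi..pi}"
    by (rule continuous_on_cis_imp_integrable)
  have mass: "circle_mean (\<lambda>z. N z * AR_kernel q a b c d z * 1) = q_Hahn_L0 q a b c d \<rho>"
    using Askey_Roy_integral[OF assms(1,2) small nz(2) N] nz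
    by (simp add: q_Hahn_L0_def qpochs_inf_def N_def AR_numerator_def qtheta_def mult_ac)
  have L: "q_Hahn_L q a b c d \<rho> n = (1 - upper_param q a b c d 0) *
      (qpoch q q n * qpoch q (a * c) n * qpoch q (a * d) n * qpoch q (b * c) n * qpoch q (b * d) n) *
      q ^ (n * (n - 1) div 2) * (- (c * d)) ^ n /
      ((1 - upper_param q a b c d n * q ^ n) * qpoch q (upper_param q a b c d 0) n) * q_Hahn_L0 q a b c d \<rho>"
  proof -
    have "a * b * c * d * q powi (- 1) = upper_param q a b c d 0"
    proof -
      have "q powi (- 1) = inverse q" by (simp add: power_int_minus)
      then show ?thesis by (simp only: upper_param_def divide_inverse power_0 mult_1_right)
    qed
    moreover have "q powi (2 * int n - 1) = q ^ n * q ^ n / q"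
    proof -
      have "2 * int n - 1 = int (n + n) - 1" by simp
      then have "q powi (2 * int n - 1) = q powi (int (n + n) - 1)" by (simp only:)
      also have "\<dots> = q powi int (n + n) / q powi 1"
        by (rule power_int_diff) (use assms(1) in blast)
      also have "\<dots> = q ^ n * q ^ n / q"
        by (simp only: power_int_of_nat power_int_1_right power_add)
      finally show ?thesis .
    qed
    then have "a * b * c * d * q powi (2 * int n - 1) = upper_param q a b c d n * q ^ n"
      by (simp only: upper_param_def times_divide_eq_left times_divide_eq_right mult.assoc)
    ultimately show ?thesis
      unfolding q_Hahn_L_def qpochs_def by (simp only: list.map prod_list.Cons prod_list.Nil mult_1_right mult.assoc)
  qed
  have "circle_mean F = q_Hahn_L q a b c d \<rho> n * (if m = n then 1 else 0)"
  \<comment> \<open>The integrand is symmetric in \<open>m\<close> and \<open>n\<close>, so the lower degree may be expanded in the basis.\<close>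
  proof (cases "m \<le> n")
    case True
    from functional_Hahn_Hahn[OF ctx True]
    show ?thesis unfolding F_def mass L by simp
  next
    case False
    then have "n \<le> m" by simp
    from functional_Hahn_Hahn[OF ctx this] False
    have "circle_mean (\<lambda>z. N z * AR_kernel q a b c d z * (q_Hahn q a b c d m z * q_Hahn q a b c d n z)) = 0"
      by simp
    also have "(\<lambda>z. N z * AR_kernel q a b c d z * (q_Hahn q a b c d m z * q_Hahn q a b c d n z)) = F"
      by (simp add: F_def fun_eq_iff)
    finally show ?thesis using False by simp
  qed
  with integrable show ?thesis
    unfolding integrand circle_mean_def by simp
qed

end
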